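(* Let $(M,g)$ be a distinguishing conformastationary spacetime, let $\psi:(M,g)\to(M,g)$ be a conformal map, let $K\in\mathrm{CTF}(M,g)$ and denote $W=\psi_*(K)$. Then, using arbitrary conformastationary decompositions $(S\times\mathbb{R},g^K)$ of $K$ and $(S\times\mathbb{R},g^W)$ of $W$, the map $\psi:(S\times\mathbb{R},g^K)\to(S\times\mathbb{R},g^W)$ is given by $\psi(x,t)=(\varphi(x),t+f(x))$ for some function $f:S\to\mathbb{R}$, where $\varphi:(S,F^K)\to(S,F^W)$ is an almost isometry between the associated Fermat metrics.
   Context: A vector field $K$ on a spacetime $(M,g)$ is conformal if $\mathcal{L}_Kg=\lambda g$ for some smooth function $\lambda$. $\mathrm{CTF}(M,g)$ is the set of complete timelike conformal vector fields; $(M,g)$ is conformastationary if $\mathrm{CTF}(M,g)\neq\emptyset$. Conformal maps are diffeomorphisms preserving $g$ up to a positive conformal factor. For $(M,g)$ distinguishing and $K\in\mathrm{CTF}(M,g)$, a $K$-conformastationary decomposition (or $K$-splitting) $(S\times\mathbb{R},g^K)$ is an identification $M\cong S\times\mathbb{R}$ under which $K=\partial_t$ (the coordinate field of the $\mathbb{R}$ factor) and the metric becomes $$g^K((v,\tau),(v,\tau))=\Omega^K\big(g_0^K(v,v)+2\omega^K(v)\tau-\tau^2\big),\qquad (v,\tau)\in TS\times\mathbb{R},$$ with $\Omega^K>0$ a smooth function on $S\times\mathbb{R}$, $g_0^K$ a Riemannian metric and $\omega^K$ a one-form on $S$; such decompositions always exist. The associated Fermat metric is the Randers (Finsler) metric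 on $S$ $$F^K(v)=\sqrt{g_0^K(v,v)+\omega^K(v)^2}+\omega^K(v).$$ For a Finsler metric $F$, $d_F(p,q)$ is the infimum of $\int F(\dot\gamma)\,ds$ over piecewise smooth curves $\gamma$ from $p$ to $q$ (in general not symmetric). A bijection $\varphi:(S,F_1)\to(S,F_2)$ is an almost isometry if $T_2(\varphi(x),\varphi(y),\varphi(z))=T_1(x,y,z)$ for all $x,y,z\in S$, where $T_i(x,y,z)=d_{F_i}(x,y)+d_{F_i}(y,z)-d_{F_i}(x,z)$. *)

theory Defs
  imports "HOL-Analysis.Analysis"
begin

section \<open>Smooth maps between open subsets of normed spaces\<close>

text \<open>Meant for open sets only: on these, \<open>C\<^sup>k\<close> is the usual notion.\<close>

primrec Ck_on ::
    "nat \<Rightarrow> 'a::real_normed_vector set \<Rightarrow> ('a \<Rightarrow> 'b::real_normed_vector) \<Rightarrow> bool" where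
  "Ck_on 0 X f \<longleftrightarrow> continuous_on X f"
| "Ck_on (Suc k) X f \<longleftrightarrow> (\<forall>x\<in>X. f differentiable (at x)) \<and>
     (\<forall>v. Ck_on k X (\<lambda>x. frechet_derivative f (at x) v))"

definition smooth_on ::
    "'a::real_normed_vector set \<Rightarrow> ('a \<Rightarrow> 'b::real_normed_vector) \<Rightarrow> bool" where
  "smooth_on X f \<longleftrightarrow> (\<forall>k. Ck_on k X f)"

section \<open>Smooth manifolds\<close>

text \<open>
  A chart is a pair of an open domain and a map which is only relevant on that domain. The
  underlying set of a manifold is a whole type (Hausdorff and second countable by its sort), and
  the smooth structure is given by an atlas, not necessarily maximal.

  The tangent space at \<open>p\<close> is represented by the model space \<open>'e\<close> through the distinguished chart
  \<open>chart_at M p\<close>. Thus a tangent vector at \<open>p\<close> is an element of \<open>'e\<close>, its coordinates in an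
  arbitrary chart \<open>c\<close> around \<open>p\<close> are obtained by applying the differential of \<open>c\<close>
  (see \<open>mderiv\<close> below), and smoothness of tensor fields is always tested in these coordinates.
\<close>

type_synonym ('m, 'e) chart = "'m set \<times> ('m \<Rightarrow> 'e)"

record ('m, 'e) mfd =
  atlas :: "('m, 'e) chart set"
  chart_at :: "'m \<Rightarrow> ('m, 'e) chart"

definition chart_inv :: "('m, 'e) chart \<Rightarrow> 'e \<Rightarrow> 'm" where
  "chart_inv c = inv_into (fst c) (snd c)"

definition is_chart :: "('m::topological_space, 'e::euclidean_space) chart \<Rightarrow> bool" where
  "is_chart c \<longleftrightarrow> open (fst c) \<and> inj_on (snd c) (fst c) \<and> open (snd c ` fst c) \<and>
     homeomorphism (fst c) (snd c ` fst c) (snd c) (chart_inv c)"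

definition smooth_manifold ::
    "('m::{t2_space,second_countable_topology}, 'e::euclidean_space) mfd \<Rightarrow> bool" where
  "smooth_manifold M \<longleftrightarrow>
     (\<forall>c\<in>atlas M. is_chart c) \<and>
     (\<forall>c\<in>atlas M. \<forall>d\<in>atlas M. smooth_on (snd c ` (fst c \<inter> fst d)) (snd d \<circ> chart_inv c)) \<and>
     (\<forall>p. chart_at M p \<in> atlas M \<and> p \<in> fst (chart_at M p))"

definition euclid :: "('e::euclidean_space, 'e) mfd" where
  "euclid = \<lparr>atlas = {(UNIV, id)}, chart_at = (\<lambda>_. (UNIV, id))\<rparr>"

definition times_line_chart :: "('s, 'e) chart \<Rightarrow> ('s \<times> real, 'e \<times> real) chart" where
  "times_line_chart c = (fst c \<times> UNIV, \<lambda>(x, t). (snd c x, t))"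

text \<open>The product manifold of \<open>S\<close> and the real line. By the choice of the distinguished charts,
  the tangent space at \<open>(x, t)\<close> is literally the product of the one at \<open>x\<close> and \<open>real\<close>.\<close>

definition times_line :: "('s, 'e) mfd \<Rightarrow> ('s \<times> real, 'e \<times> real) mfd" where
  "times_line S = \<lparr>atlas = times_line_chart ` atlas S,
                   chart_at = (\<lambda>z. times_line_chart (chart_at S (fst z)))\<rparr>"

definition smooth_map_on ::
    "('m::topological_space, 'e::euclidean_space) mfd \<Rightarrow>
     ('n::topological_space, 'f::euclidean_space) mfd \<Rightarrow> 'm set \<Rightarrow> ('m \<Rightarrow> 'n) \<Rightarrow> bool" where
  "smooth_map_on M N X f \<longleftrightarrow> continuous_on X f \<and>
     (\<forall>c\<in>atlas M. \<forall>d\<in>atlas N.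
        smooth_on (snd c ` {p \<in> X \<inter> fst c. f p \<in> fst d}) (snd d \<circ> f \<circ> chart_inv c))"

abbreviation smooth_map where
  "smooth_map M N f \<equiv> smooth_map_on M N UNIV f"

definition diffeomorphism ::
    "('m::topological_space, 'e::euclidean_space) mfd \<Rightarrow>
     ('n::topological_space, 'f::euclidean_space) mfd \<Rightarrow> ('m \<Rightarrow> 'n) \<Rightarrow> bool" where
  "diffeomorphism M N f \<longleftrightarrow> bij f \<and> smooth_map M N f \<and> smooth_map N M (inv f)"

text \<open>The differential of \<open>f\<close> at \<open>p\<close>, between tangent spaces as represented above. For a chart
  \<open>c\<close> of \<open>M\<close>, \<open>mderiv M euclid (snd c) p\<close> sends a tangent vector to its coordinates in \<open>c\<close>, and
  \<open>mderiv euclid M (chart_inv c)\<close> goes the other way.\<close>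

definition mderiv ::
    "('m, 'e::euclidean_space) mfd \<Rightarrow> ('n, 'f::euclidean_space) mfd \<Rightarrow>
     ('m \<Rightarrow> 'n) \<Rightarrow> 'm \<Rightarrow> 'e \<Rightarrow> 'f" where
  "mderiv M N f p = frechet_derivative
     (snd (chart_at N (f p)) \<circ> f \<circ> chart_inv (chart_at M p)) (at (snd (chart_at M p) p))"

definition velocity :: "('m, 'e::euclidean_space) mfd \<Rightarrow> (real \<Rightarrow> 'm) \<Rightarrow> real \<Rightarrow> 'e" where
  "velocity M \<gamma> s = mderiv euclid M \<gamma> s 1"

section \<open>Tensor fields\<close>

text \<open>The following three functions give coordinates in a chart \<open>c\<close>, as functions of a point \<open>y\<close>
  in the image of \<open>c\<close>.\<close>

definition field_coord ::
    "('m, 'e::euclidean_space) mfd \<Rightarrow> ('m, 'e) chart \<Rightarrow> ('m \<Rightarrow> 'e) \<Rightarrow> 'e \<Rightarrow> 'e" where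
  "field_coord M c X y = mderiv M euclid (snd c) (chart_inv c y) (X (chart_inv c y))"

definition covector_coord ::
    "('m, 'e::euclidean_space) mfd \<Rightarrow> ('m, 'e) chart \<Rightarrow> ('m \<Rightarrow> 'e \<Rightarrow> real) \<Rightarrow> 'e \<Rightarrow> 'e \<Rightarrow> real" where
  "covector_coord M c \<omega> y u = \<omega> (chart_inv c y) (mderiv euclid M (chart_inv c) y u)"

definition bilin_coord ::
    "('m, 'e::euclidean_space) mfd \<Rightarrow> ('m, 'e) chart \<Rightarrow>
     ('m \<Rightarrow> 'e \<Rightarrow> 'e \<Rightarrow> real) \<Rightarrow> 'e \<Rightarrow> 'e \<Rightarrow> 'e \<Rightarrow> real" where
  "bilin_coord M c g y u v =
     g (chart_inv c y) (mderiv euclid M (chart_inv c) y u) (mderiv euclid M (chart_inv c) y v)"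

definition vector_field :: "('m, 'e::euclidean_space) mfd \<Rightarrow> ('m \<Rightarrow> 'e) \<Rightarrow> bool" where
  "vector_field M X \<longleftrightarrow> (\<forall>c\<in>atlas M. smooth_on (snd c ` fst c) (field_coord M c X))"

definition one_form :: "('m, 'e::euclidean_space) mfd \<Rightarrow> ('m \<Rightarrow> 'e \<Rightarrow> real) \<Rightarrow> bool" where
  "one_form M \<omega> \<longleftrightarrow> (\<forall>p. linear (\<omega> p)) \<and>
     (\<forall>c\<in>atlas M. \<forall>u. smooth_on (snd c ` fst c) (\<lambda>y. covector_coord M c \<omega> y u))"

definition sym_tensor :: "('m, 'e::euclidean_space) mfd \<Rightarrow> ('m \<Rightarrow> 'e \<Rightarrow> 'e \<Rightarrow> real) \<Rightarrow> bool" where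
  "sym_tensor M g \<longleftrightarrow> (\<forall>p. bilinear (g p) \<and> (\<forall>u v. g p u v = g p v u)) \<and>
     (\<forall>c\<in>atlas M. \<forall>u v. smooth_on (snd c ` fst c) (\<lambda>y. bilin_coord M c g y u v))"

definition riemannian_metric ::
    "('m, 'e::euclidean_space) mfd \<Rightarrow> ('m \<Rightarrow> 'e \<Rightarrow> 'e \<Rightarrow> real) \<Rightarrow> bool" where
  "riemannian_metric M g \<longleftrightarrow> sym_tensor M g \<and> (\<forall>p v. v \<noteq> 0 \<longrightarrow> 0 < g p v v)"

definition negative_definite_on :: "('e::euclidean_space \<Rightarrow> 'e \<Rightarrow> real) \<Rightarrow> 'e set \<Rightarrow> bool" where
  "negative_definite_on b V \<longleftrightarrow> (\<forall>v\<in>V. v \<noteq> 0 \<longrightarrow> b v v < 0)"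

text \<open>Lorentzian means nondegenerate of index one, the index being the largest dimension of a
  subspace on which the form is negative definite.\<close>

definition lorentzian_metric ::
    "('m, 'e::euclidean_space) mfd \<Rightarrow> ('m \<Rightarrow> 'e \<Rightarrow> 'e \<Rightarrow> real) \<Rightarrow> bool" where
  "lorentzian_metric M g \<longleftrightarrow> sym_tensor M g \<and>
     (\<forall>p. (\<forall>u. u \<noteq> 0 \<longrightarrow> (\<exists>v. g p u v \<noteq> 0)) \<and>
          (\<exists>V. subspace V \<and> negative_definite_on (g p) V \<and> dim V = 1) \<and>
          (\<forall>V. subspace V \<and> negative_definite_on (g p) V \<longrightarrow> dim V \<le> 1))"

text \<open>The Lie derivative of \<open>g\<close> along \<open>X\<close>, computed at \<open>p\<close> in the distinguished chart at \<open>p\<close>: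
  \<open>X\<^sup>k \<partial>\<^sub>k g\<^sub>i\<^sub>j + g\<^sub>k\<^sub>j \<partial>\<^sub>i X\<^sup>k + g\<^sub>i\<^sub>k \<partial>\<^sub>j X\<^sup>k\<close>.\<close>

definition lie_derivative ::
    "('m, 'e::euclidean_space) mfd \<Rightarrow> ('m \<Rightarrow> 'e) \<Rightarrow> ('m \<Rightarrow> 'e \<Rightarrow> 'e \<Rightarrow> real) \<Rightarrow>
     'm \<Rightarrow> 'e \<Rightarrow> 'e \<Rightarrow> real" where
  "lie_derivative M X g p u v =
     (let c = chart_at M p; y = snd c p;
          Y = field_coord M c X; h = bilin_coord M c g;
          DY = frechet_derivative Y (at y)
      in frechet_derivative (\<lambda>z. h z u v) (at y) (Y y) + h y (DY u) v + h y u (DY v))"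

definition pushforward ::
    "('m, 'e::euclidean_space) mfd \<Rightarrow> ('n, 'f::euclidean_space) mfd \<Rightarrow>
     ('m \<Rightarrow> 'n) \<Rightarrow> ('m \<Rightarrow> 'e) \<Rightarrow> 'n \<Rightarrow> 'f" where
  "pushforward M N f X q = mderiv M N f (inv f q) (X (inv f q))"

definition complete_field ::
    "('m::topological_space, 'e::euclidean_space) mfd \<Rightarrow> ('m \<Rightarrow> 'e) \<Rightarrow> bool" where
  "complete_field M X \<longleftrightarrow>
     (\<forall>p. \<exists>\<gamma>. smooth_map euclid M \<gamma> \<and> \<gamma> 0 = p \<and> (\<forall>s. velocity M \<gamma> s = X (\<gamma> s)))"

section \<open>Piecewise smooth curves\<close>

text \<open>A curve on \<open>[a, b]\<close> that is smooth on each closed piece of a subdivision, where smoothness on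
  a closed interval means having a smooth extension \<open>\<delta>\<close> to an open neighbourhood. The condition
  \<open>Q\<close> is imposed on all velocities of all pieces, so on both one-sided ones at break points.\<close>

definition piecewise_curve ::
    "('m::topological_space, 'e::euclidean_space) mfd \<Rightarrow> ('m \<Rightarrow> 'e \<Rightarrow> bool) \<Rightarrow>
     (real \<Rightarrow> 'm) \<Rightarrow> real \<Rightarrow> real \<Rightarrow> bool" where
  "piecewise_curve M Q \<gamma> a b \<longleftrightarrow> a < b \<and>
     (\<exists>(n::nat) s. s 0 = a \<and> s n = b \<and>
        (\<forall>i<n. s i < s (Suc i) \<and>
           (\<exists>J \<delta>. open J \<and> {s i..s (Suc i)} \<subseteq> J \<and> smooth_map_on euclid M J \<delta> \<and>
              (\<forall>t\<in>{s i..s (Suc i)}. \<gamma> t = \<delta> t \<and> Q (\<delta> t) (velocity M \<delta> t)))))"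

abbreviation piecewise_smooth_curve where
  "piecewise_smooth_curve M \<gamma> a b \<equiv> piecewise_curve M (\<lambda>_ _. True) \<gamma> a b"

section \<open>Spacetimes\<close>

text \<open>The time orientation is given by a timelike vector field \<open>T\<close>, declared to be future-pointing.
  The metric has signature \<open>(+, \<dots>, +, -)\<close>.\<close>

definition timelike_field :: "('m \<Rightarrow> 'e \<Rightarrow> 'e \<Rightarrow> real) \<Rightarrow> ('m \<Rightarrow> 'e) \<Rightarrow> bool" where
  "timelike_field g X \<longleftrightarrow> (\<forall>p. g p (X p) (X p) < 0)"

definition spacetime ::
    "('m::{t2_space,second_countable_topology}, 'e::euclidean_space) mfd \<Rightarrow>
     ('m \<Rightarrow> 'e \<Rightarrow> 'e \<Rightarrow> real) \<Rightarrow> ('m \<Rightarrow> 'e) \<Rightarrow> bool" where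
  "spacetime M g T \<longleftrightarrow> smooth_manifold M \<and> connected (UNIV :: 'm set) \<and> 2 \<le> DIM('e) \<and>
     lorentzian_metric M g \<and> vector_field M T \<and> timelike_field g T"

definition chronological ::
    "('m::topological_space, 'e::euclidean_space) mfd \<Rightarrow>
     ('m \<Rightarrow> 'e \<Rightarrow> 'e \<Rightarrow> real) \<Rightarrow> ('m \<Rightarrow> 'e) \<Rightarrow> 'm \<Rightarrow> 'm \<Rightarrow> bool" where
  "chronological M g T p q \<longleftrightarrow>
     (\<exists>\<gamma> a b. piecewise_curve M (\<lambda>x v. g x v v < 0 \<and> g x (T x) v < 0) \<gamma> a b \<and> \<gamma> a = p \<and> \<gamma> b = q)"

text \<open>Distinguishing means both future and past distinguishing.\<close>

definition distinguishing ::
    "('m::topological_space, 'e::euclidean_space) mfd \<Rightarrow>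
     ('m \<Rightarrow> 'e \<Rightarrow> 'e \<Rightarrow> real) \<Rightarrow> ('m \<Rightarrow> 'e) \<Rightarrow> bool" where
  "distinguishing M g T \<longleftrightarrow>
     (\<forall>p q. {r. chronological M g T p r} = {r. chronological M g T q r} \<longrightarrow> p = q) \<and>
     (\<forall>p q. {r. chronological M g T r p} = {r. chronological M g T r q} \<longrightarrow> p = q)"

definition conformal_field ::
    "('m::topological_space, 'e::euclidean_space) mfd \<Rightarrow>
     ('m \<Rightarrow> 'e \<Rightarrow> 'e \<Rightarrow> real) \<Rightarrow> ('m \<Rightarrow> 'e) \<Rightarrow> bool" where
  "conformal_field M g K \<longleftrightarrow> vector_field M K \<and>
     (\<exists>l :: 'm \<Rightarrow> real. smooth_map M euclid l \<and>
        (\<forall>p u v. lie_derivative M K g p u v = l p * g p u v))"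

definition CTF ::
    "('m::topological_space, 'e::euclidean_space) mfd \<Rightarrow>
     ('m \<Rightarrow> 'e \<Rightarrow> 'e \<Rightarrow> real) \<Rightarrow> ('m \<Rightarrow> 'e) set" where
  "CTF M g = {K. conformal_field M g K \<and> complete_field M K \<and> timelike_field g K}"

definition conformastationary ::
    "('m::topological_space, 'e::euclidean_space) mfd \<Rightarrow> ('m \<Rightarrow> 'e \<Rightarrow> 'e \<Rightarrow> real) \<Rightarrow> bool" where
  "conformastationary M g \<longleftrightarrow> CTF M g \<noteq> {}"

definition conformal_map ::
    "('m::topological_space, 'e::euclidean_space) mfd \<Rightarrow> ('m \<Rightarrow> 'e \<Rightarrow> 'e \<Rightarrow> real) \<Rightarrow>
     ('n::topological_space, 'f::euclidean_space) mfd \<Rightarrow> ('n \<Rightarrow> 'f \<Rightarrow> 'f \<Rightarrow> real) \<Rightarrow>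
     ('m \<Rightarrow> 'n) \<Rightarrow> bool" where
  "conformal_map M g N h f \<longleftrightarrow> diffeomorphism M N f \<and>
     (\<exists>\<mu> :: 'm \<Rightarrow> real. smooth_map M euclid \<mu> \<and> (\<forall>p. 0 < \<mu> p) \<and>
        (\<forall>p u v. h (f p) (mderiv M N f p u) (mderiv M N f p v) = \<mu> p * g p u v))"

text \<open>A \<open>K\<close>-splitting of \<open>(M, g)\<close> over \<open>S\<close>: the identification is the diffeomorphism \<open>\<Phi>\<close>, and
  \<open>(0, 1)\<close> is the coordinate field of the line factor.\<close>

definition conformastationary_decomposition ::
    "('m::topological_space, 'e::euclidean_space) mfd \<Rightarrow> ('m \<Rightarrow> 'e \<Rightarrow> 'e \<Rightarrow> real) \<Rightarrow>
     ('m \<Rightarrow> 'e) \<Rightarrow> ('s::topological_space, 'f::euclidean_space) mfd \<Rightarrow>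
     ('s \<times> real \<Rightarrow> 'm) \<Rightarrow> ('s \<times> real \<Rightarrow> real) \<Rightarrow>
     ('s \<Rightarrow> 'f \<Rightarrow> 'f \<Rightarrow> real) \<Rightarrow> ('s \<Rightarrow> 'f \<Rightarrow> real) \<Rightarrow> bool" where
  "conformastationary_decomposition M g K S \<Phi> \<Omega> g0 \<omega> \<longleftrightarrow>
     diffeomorphism (times_line S) M \<Phi> \<and>
     (\<forall>z. mderiv (times_line S) M \<Phi> z (0, 1) = K (\<Phi> z)) \<and>
     smooth_map (times_line S) euclid \<Omega> \<and> (\<forall>z. 0 < \<Omega> z) \<and>
     riemannian_metric S g0 \<and> one_form S \<omega> \<and>
     (\<forall>x t v \<tau>. g (\<Phi> (x, t)) (mderiv (times_line S) M \<Phi> (x, t) (v, \<tau>))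
                              (mderiv (times_line S) M \<Phi> (x, t) (v, \<tau>)) =
        \<Omega> (x, t) * (g0 x v v + 2 * \<omega> x v * \<tau> - \<tau>\<^sup>2))"

section \<open>Fermat metrics and almost isometries\<close>

definition fermat_metric ::
    "('s \<Rightarrow> 'f \<Rightarrow> 'f \<Rightarrow> real) \<Rightarrow> ('s \<Rightarrow> 'f \<Rightarrow> real) \<Rightarrow> 's \<Rightarrow> 'f \<Rightarrow> real" where
  "fermat_metric g0 \<omega> x v = sqrt (g0 x v v + (\<omega> x v)\<^sup>2) + \<omega> x v"

text \<open>The infimum is real-valued, hence meaningful when \<open>S\<close> is connected and \<open>F\<close> nonnegative. The
  finitely many break points do not affect the integral.\<close>

definition finsler_dist ::
    "('s::topological_space, 'f::euclidean_space) mfd \<Rightarrow> ('s \<Rightarrow> 'f \<Rightarrow> real) \<Rightarrow> 's \<Rightarrow> 's \<Rightarrow> real" where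
  "finsler_dist S F p q = Inf {integral {a..b} (\<lambda>s. F (\<gamma> s) (velocity S \<gamma> s)) | \<gamma> a b.
     piecewise_smooth_curve S \<gamma> a b \<and> \<gamma> a = p \<and> \<gamma> b = q}"

definition triangular ::
    "('s::topological_space, 'f::euclidean_space) mfd \<Rightarrow> ('s \<Rightarrow> 'f \<Rightarrow> real) \<Rightarrow>
     's \<Rightarrow> 's \<Rightarrow> 's \<Rightarrow> real" where
  "triangular S F x y z = finsler_dist S F x y + finsler_dist S F y z - finsler_dist S F x z"

definition almost_isometry ::
    "('s::topological_space, 'f::euclidean_space) mfd \<Rightarrow> ('s \<Rightarrow> 'f \<Rightarrow> real) \<Rightarrow>
     ('s \<Rightarrow> 'f \<Rightarrow> real) \<Rightarrow> ('s \<Rightarrow> 's) \<Rightarrow> bool" where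
  "almost_isometry S F1 F2 \<phi> \<longleftrightarrow> bij \<phi> \<and>
     (\<forall>x y z. triangular S F2 (\<phi> x) (\<phi> y) (\<phi> z) = triangular S F1 x y z)"

end

theory Submission
  imports Defs
begin

text \<open>
  Let \<open>G = \<Phi>W\<inverse> \<circ> \<psi> \<circ> \<Phi>K\<close>, a diffeomorphism of \<open>S \<times> \<real>\<close>. Both splittings turn their vector
  field into the coordinate field of the line, and \<open>\<psi>\<close> pushes the one field to the other; hence
  \<open>G\<close> preserves the coordinate field and maps its integral curves, the lines \<open>{x} \<times> \<real>\<close>, to
  integral curves. So \<open>G (x, t) = (\<phi> x, t + f x)\<close> with a diffeomorphism \<open>\<phi>\<close> of \<open>S\<close> and a smooth
  function \<open>f\<close> (lemmas \<open>translation_equivariant\<close> and \<open>diffeomorphism_base\<close>).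

  As \<open>\<psi>\<close> is conformal, \<open>G\<close> takes the quadratic form \<open>gK(v,v) + 2 \<omega>K(v) \<tau> - \<tau>\<^sup>2\<close> to a positive
  multiple of the same expression for \<open>W\<close> at \<open>(d\<phi>(v), \<tau> + df(v))\<close>. The coefficient of \<open>\<tau>\<^sup>2\<close> shows
  that the multiple is \<open>1\<close>, and comparing the other coefficients gives \<open>F\<^sup>W(d\<phi>(v)) = F\<^sup>K(v) + df(v)\<close>
  for the Fermat metrics (lemma \<open>fermat_metric_translate\<close>). Integration along a curve from \<open>x\<close> to
  \<open>y\<close> and its image under \<open>\<phi>\<close> changes the length by \<open>f y - f x\<close>, whatever the curve, so that the
  distances satisfy \<open>d\<^sup>W(\<phi> x, \<phi> y) = d\<^sup>K(x, y) + f y - f x\<close> (lemma \<open>finsler_dist_translate\<close>). These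
  differences cancel in the triangular function, which is the assertion that \<open>\<phi>\<close> is an almost
  isometry.

  Most of the work goes into the differential calculus behind this: composition of \<open>C\<^sup>k\<close> maps, the
  chain rule for differentials that are represented in distinguished charts, continuity of
  the Fermat metrics along smooth curves (which makes the lengths additive), and existence of curves
  between any two points of \<open>S\<close> (without which the infimum defining the distance would be over the
  empty set).
\<close>

section \<open>Calculus of \<open>C\<^sup>k\<close> maps\<close>

lemma Ck_on_cong:
  assumes "open X" "\<And>x. x \<in> X \<Longrightarrow> f x = g x" "Ck_on k X f"
  shows "Ck_on k X g"
  using assms(2,3)
proof (induction k arbitrary: f g)
  case 0
  then show ?case by (simp cong: continuous_on_cong)
next
  case (Suc k)
  have diff: "f differentiable at x" if "x \<in> X" for x
    using Suc.prems that by simp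
  have eq: "frechet_derivative f (at x) = frechet_derivative g (at x)" if "x \<in> X" for x
    using frechet_derivative_transform_within_open[OF diff \<open>open X\<close> that] that Suc.prems(1) by blast
  have "g differentiable at x" if "x \<in> X" for x
    using diff[OF that] has_derivative_transform_within_open[OF _ \<open>open X\<close> that] Suc.prems(1)
    unfolding differentiable_def by blast
  moreover have "Ck_on k X (\<lambda>x. frechet_derivative g (at x) v)" for v
    using Suc.IH[of "\<lambda>x. frechet_derivative f (at x) v"] eq Suc.prems(2) by simp
  ultimately show ?case by simp
qed

lemma Ck_on_subset: "Ck_on k X f \<Longrightarrow> Y \<subseteq> X \<Longrightarrow> Ck_on k Y f"
  by (induction k arbitrary: f) (auto intro: continuous_on_subset)

lemma Ck_on_lower: "Ck_on (Suc k) X f \<Longrightarrow> Ck_on k X f"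
proof (induction k arbitrary: f)
  case 0
  then show ?case
    by (auto intro!: continuous_at_imp_continuous_on differentiable_imp_continuous_within)
qed simp

text \<open>Smoothness of a map between manifolds is only checked near each point, each time in suitable
  charts; this lemma glues these local results.\<close>

lemma Ck_on_local:
  assumes "\<And>x. x \<in> X \<Longrightarrow> \<exists>U. open U \<and> x \<in> U \<and> Ck_on k U f"
  shows "Ck_on k X f"
  using assms
proof (induction k arbitrary: f)
  case 0
  have "isCont f x" if x: "x \<in> X" for x
    using 0[OF x] by (auto simp: continuous_on_eq_continuous_at)
  then show ?case by (simp add: continuous_at_imp_continuous_on)
next
  case (Suc k)
  have "f differentiable at x" if "x \<in> X" for x
    using Suc.prems[OF that] by auto
  moreover have "Ck_on k X (\<lambda>x. frechet_derivative f (at x) v)" for v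
  proof (rule Suc.IH)
    fix x assume "x \<in> X"
    then show "\<exists>U. open U \<and> x \<in> U \<and> Ck_on k U (\<lambda>x. frechet_derivative f (at x) v)"
      using Suc.prems[of x] by auto
  qed
  ultimately show ?case by simp
qed

lemma Ck_on_const: "Ck_on k X (\<lambda>x. c)"
  by (induction k arbitrary: c) auto

lemma Ck_on_linear:
  assumes "bounded_linear L"
  shows "Ck_on k X L"
proof (cases k)
  case 0
  then show ?thesis using assms linear_continuous_on by auto
next
  case (Suc m)
  have D: "(L has_derivative L) (at x)" for x
    using assms bounded_linear_imp_has_derivative by blast
  moreover have "frechet_derivative L (at x) = L" for x
    using frechet_derivative_at[OF D] by simp
  ultimately show ?thesis
    using Suc by (auto simp: Ck_on_const differentiable_def)
qed

lemma Ck_on_linear_comp: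
  assumes "open X" "bounded_linear L" "Ck_on k X f"
  shows "Ck_on k X (\<lambda>x. L (f x))"
  using assms(3)
proof (induction k arbitrary: f)
  case 0
  then show ?case using assms(2) bounded_linear.continuous_on by auto
next
  case (Suc k)
  have D: "((\<lambda>x. L (f x)) has_derivative (\<lambda>v. L (frechet_derivative f (at x) v))) (at x)"
    if "x \<in> X" for x
  proof (rule bounded_linear.has_derivative[OF assms(2)])
    show "(f has_derivative frechet_derivative f (at x)) (at x)"
      using Suc.prems that by (simp flip: frechet_derivative_works)
  qed
  have "Ck_on k X (\<lambda>x. frechet_derivative (\<lambda>x. L (f x)) (at x) v)" for v
    by (rule Ck_on_cong[OF \<open>open X\<close> _ Suc.IH[of "\<lambda>x. frechet_derivative f (at x) v"]])
      (use frechet_derivative_at[OF D] Suc.prems in \<open>auto dest!: fun_cong\<close>)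
  then show ?case using D by (auto simp: differentiable_def)
qed

lemma Ck_on_add:
  assumes "open X" "Ck_on k X f" "Ck_on k X g"
  shows "Ck_on k X (\<lambda>x. f x + g x)"
  using assms(2,3)
proof (induction k arbitrary: f g)
  case 0
  then show ?case by (simp add: continuous_on_add)
next
  case (Suc k)
  have D: "((\<lambda>x. f x + g x) has_derivative
      (\<lambda>v. frechet_derivative f (at x) v + frechet_derivative g (at x) v)) (at x)"
    if "x \<in> X" for x
    using has_derivative_add Suc.prems that by (simp add: frechet_derivative_works)
  have "Ck_on k X (\<lambda>x. frechet_derivative (\<lambda>x. f x + g x) (at x) v)" for v
    by (rule Ck_on_cong[OF \<open>open X\<close> _ Suc.IH[of "\<lambda>x. frechet_derivative f (at x) v"
          "\<lambda>x. frechet_derivative g (at x) v"]])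
      (use frechet_derivative_at[OF D] Suc.prems in \<open>auto dest!: fun_cong\<close>)
  then show ?case using D by (auto simp: differentiable_def)
qed

lemma Ck_on_sum:
  assumes "open X" "finite I" "\<And>i. i \<in> I \<Longrightarrow> Ck_on k X (f i)"
  shows "Ck_on k X (\<lambda>x. \<Sum>i\<in>I. f i x)"
  using assms(2,3)
  by (induction I rule: finite_induct) (auto simp: Ck_on_const intro!: Ck_on_add assms(1))

lemma Ck_on_scaleR:
  assumes "open X" "Ck_on k X a" "Ck_on k X f"
  shows "Ck_on k X (\<lambda>x. a x *\<^sub>R f x)"
  using assms(2,3)
proof (induction k arbitrary: a f)
  case 0
  then show ?case by (simp add: continuous_on_scaleR)
next
  case (Suc k)
  let ?D = "\<lambda>v x. a x *\<^sub>R frechet_derivative f (at x) v + frechet_derivative a (at x) v *\<^sub>R f x"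
  have D: "((\<lambda>x. a x *\<^sub>R f x) has_derivative (\<lambda>v. ?D v x)) (at x)" if "x \<in> X" for x
    using has_derivative_scaleR Suc.prems that by (simp add: frechet_derivative_works)
  have "Ck_on k X (?D v)" for v
    using Suc Ck_on_lower[OF Suc.prems(1)] Ck_on_lower[OF Suc.prems(2)]
    by (intro Ck_on_add assms(1)) auto
  then have "Ck_on k X (\<lambda>x. frechet_derivative (\<lambda>x. a x *\<^sub>R f x) (at x) v)" for v
    by (rule Ck_on_cong[OF \<open>open X\<close>, rotated])
      (use frechet_derivative_at[OF D] in \<open>auto dest!: fun_cong\<close>)
  then show ?case using D by (auto simp: differentiable_def)
qed

text \<open>The derivative of a composition is \<open>g'(f(x)) (f'(x) v)\<close>, where both the point and the vector
  vary with \<open>x\<close>, while \<open>Ck_on\<close> only speaks of \<open>g'\<close> applied to constant vectors. Expanding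
  \<open>f'(x) v\<close> in an orthonormal basis turns it into a sum of products, to which the induction
  hypothesis and the product rule apply.\<close>

lemma Ck_on_compose:
  fixes f :: "'a::real_normed_vector \<Rightarrow> 'b::euclidean_space"
  assumes "open X" "f ` X \<subseteq> Y" "Ck_on k X f" "Ck_on k Y g"
  shows "Ck_on k X (g \<circ> f)"
  using assms(3,4)
proof (induction k arbitrary: g)
  case 0
  then show ?case
    using assms(2) continuous_on_compose2[of Y g X f] by (simp add: o_def)
next
  case (Suc k)
  have df: "f differentiable at x" and dg: "g differentiable at (f x)" if "x \<in> X" for x
    using Suc.prems assms(2) that by auto
  let ?D = "\<lambda>v x. \<Sum>b\<in>Basis. (frechet_derivative f (at x) v \<bullet> b) *\<^sub>R frechet_derivative g (at (f x)) b"
  have eq: "?D v x = frechet_derivative (g \<circ> f) (at x) v" if "x \<in> X" for x v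
  proof -
    interpret linear "frechet_derivative g (at (f x))"
      using linear_frechet_derivative dg[OF that] .
    have "?D v x = frechet_derivative g (at (f x)) (frechet_derivative f (at x) v)"
      by (subst (3) euclidean_representation[symmetric]) (simp add: sum scale)
    then show ?thesis using frechet_derivative_compose[OF df dg] that by simp
  qed
  have "Ck_on k X (?D v)" for v
  proof (intro Ck_on_sum Ck_on_scaleR assms(1) finite_Basis)
    fix b :: 'b
    show "Ck_on k X (\<lambda>x. frechet_derivative f (at x) v \<bullet> b)"
      by (rule Ck_on_linear_comp[OF assms(1) bounded_linear_inner_left]) (use Suc.prems in simp)
    show "Ck_on k X (\<lambda>x. frechet_derivative g (at (f x)) b)"
      using Suc.IH[of "\<lambda>y. frechet_derivative g (at y) b", OF Ck_on_lower[OF Suc.prems(1)]]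
        Suc.prems(2) by (simp add: o_def)
  qed
  then have "Ck_on k X (\<lambda>x. frechet_derivative (g \<circ> f) (at x) v)" for v
    by (rule Ck_on_cong[OF assms(1) eq, rotated])
  moreover have "g \<circ> f differentiable at x" if "x \<in> X" for x
    using differentiable_chain_at df dg that by blast
  ultimately show ?case by (simp add: o_def)
qed

lemma smooth_on_cong:
  "open X \<Longrightarrow> (\<And>x. x \<in> X \<Longrightarrow> f x = g x) \<Longrightarrow> smooth_on X f \<Longrightarrow> smooth_on X g"
  unfolding smooth_on_def using Ck_on_cong by blast

lemma smooth_on_subset: "smooth_on X f \<Longrightarrow> Y \<subseteq> X \<Longrightarrow> smooth_on Y f"
  unfolding smooth_on_def using Ck_on_subset by blast

lemma smooth_on_local:
  assumes "\<And>x. x \<in> X \<Longrightarrow> \<exists>U. open U \<and> x \<in> U \<and> smooth_on U f"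
  shows "smooth_on X f"
  unfolding smooth_on_def
proof (intro allI Ck_on_local)
  fix k x assume "x \<in> X"
  then show "\<exists>U. open U \<and> x \<in> U \<and> Ck_on k U f"
    using assms unfolding smooth_on_def by blast
qed

lemma smooth_on_linear: "bounded_linear L \<Longrightarrow> smooth_on X L"
  unfolding smooth_on_def using Ck_on_linear by blast

lemma smooth_on_const: "smooth_on X (\<lambda>x. c)"
  unfolding smooth_on_def using Ck_on_const by blast

lemma smooth_on_linear_comp:
  "open X \<Longrightarrow> bounded_linear L \<Longrightarrow> smooth_on X f \<Longrightarrow> smooth_on X (\<lambda>x. L (f x))"
  unfolding smooth_on_def using Ck_on_linear_comp by blast

lemma smooth_on_add:
  "open X \<Longrightarrow> smooth_on X f \<Longrightarrow> smooth_on X g \<Longrightarrow> smooth_on X (\<lambda>x. f x + g x)"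
  unfolding smooth_on_def using Ck_on_add by blast

lemma smooth_on_Pair:
  assumes "open X" "smooth_on X f" "smooth_on X g"
  shows "smooth_on X (\<lambda>x. (f x, g x))"
proof -
  have "smooth_on X (\<lambda>x. (f x, 0) + (0, g x))"
    by (intro smooth_on_add smooth_on_linear_comp[where f = f and L = "\<lambda>u. (u, 0)"]
        smooth_on_linear_comp[where f = g and L = "\<lambda>u. (0, u)"] assms
        bounded_linear_Pair bounded_linear_ident bounded_linear_zero)
  then show ?thesis by simp
qed

lemma smooth_on_compose:
  fixes f :: "'a::real_normed_vector \<Rightarrow> 'b::euclidean_space"
  shows "open X \<Longrightarrow> f ` X \<subseteq> Y \<Longrightarrow> smooth_on X f \<Longrightarrow> smooth_on Y g \<Longrightarrow> smooth_on X (g \<circ> f)"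
  unfolding smooth_on_def using Ck_on_compose by blast

lemma smooth_on_imp_differentiable: "smooth_on X f \<Longrightarrow> x \<in> X \<Longrightarrow> f differentiable at x"
  unfolding smooth_on_def by (metis Ck_on.simps(2))

lemma smooth_on_imp_continuous_on: "smooth_on X f \<Longrightarrow> continuous_on X f"
  unfolding smooth_on_def by (metis Ck_on.simps(1))

lemma smooth_on_imp_continuous_derivative:
  "smooth_on X f \<Longrightarrow> continuous_on X (\<lambda>x. frechet_derivative f (at x) v)"
  unfolding smooth_on_def by (metis Ck_on.simps)

section \<open>Charts, smooth maps and differentials\<close>

lemma chart_inv_left [simp]: "is_chart c \<Longrightarrow> p \<in> fst c \<Longrightarrow> chart_inv c (snd c p) = p"
  unfolding is_chart_def chart_inv_def by simp

lemma open_chart_image: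
  assumes "is_chart c" "open V"
  shows "open (snd c ` (fst c \<inter> V))"
proof -
  have "snd c ` (fst c \<inter> V) = snd c ` fst c \<inter> chart_inv c -` V"
    using assms(1) by auto
  moreover have "open (snd c ` fst c \<inter> chart_inv c -` V)"
    using assms unfolding is_chart_def homeomorphism_def
    by (auto intro!: continuous_open_preimage)
  ultimately show ?thesis by simp
qed

lemma open_chart_preimage:
  assumes "is_chart c" "open U"
  shows "open (fst c \<inter> snd c -` U)"
  using assms unfolding is_chart_def homeomorphism_def by (auto intro!: continuous_open_preimage)

lemma smooth_manifoldD:
  assumes "smooth_manifold M"
  shows "c \<in> atlas M \<Longrightarrow> is_chart c"
    and "c \<in> atlas M \<Longrightarrow> open (fst c)"
    and "c \<in> atlas M \<Longrightarrow> d \<in> atlas M \<Longrightarrow>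
      smooth_on (snd c ` (fst c \<inter> fst d)) (snd d \<circ> chart_inv c)"
    and "chart_at M p \<in> atlas M"
    and "p \<in> fst (chart_at M p)"
  using assms unfolding smooth_manifold_def is_chart_def by auto

lemma open_representative_domain:
  assumes "is_chart c" "open (fst d)" "open X" "continuous_on X f"
  shows "open (snd c ` {p \<in> X \<inter> fst c. f p \<in> fst d})"
proof -
  have "{p \<in> X \<inter> fst c. f p \<in> fst d} = fst c \<inter> (X \<inter> f -` fst d)" by auto
  then show ?thesis
    using open_chart_image[OF assms(1)] continuous_open_preimage[OF assms(4,3,2)] by simp
qed

text \<open>Smoothness asks for all pairs of charts. Around \<open>p\<close>, the representative in charts \<open>c'\<close> and
  \<open>d'\<close> is the one in \<open>c\<close> and \<open>d\<close>, composed with changes of charts on both sides; so one suitable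
  pair of charts around each point is enough.\<close>

lemma smooth_map_onI_at:
  assumes M: "smooth_manifold M" and N: "smooth_manifold N"
    and X: "open X" and f: "continuous_on X f"
    and at: "\<And>p. p \<in> X \<Longrightarrow> \<exists>c\<in>atlas M. \<exists>d\<in>atlas N. p \<in> fst c \<and> f p \<in> fst d \<and>
      (\<exists>U. open U \<and> snd c p \<in> U \<and> smooth_on U (snd d \<circ> f \<circ> chart_inv c))"
  shows "smooth_map_on M N X f"
  unfolding smooth_map_on_def
proof (intro conjI ballI f smooth_on_local)
  fix c' d' y
  assume c': "c' \<in> atlas M" and d': "d' \<in> atlas N"
    and "y \<in> snd c' ` {p \<in> X \<inter> fst c'. f p \<in> fst d'}"
  then obtain p where p: "p \<in> X" "p \<in> fst c'" "f p \<in> fst d'" "y = snd c' p" by auto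
  obtain c d U where c: "c \<in> atlas M" and d: "d \<in> atlas N" and pc: "p \<in> fst c" "f p \<in> fst d"
    and U: "open U" "snd c p \<in> U" "smooth_on U (snd d \<circ> f \<circ> chart_inv c)"
    using at[OF p(1)] by blast
  note charts = smooth_manifoldD(1)[OF M c] smooth_manifoldD(1)[OF M c']
    smooth_manifoldD(1)[OF N d] smooth_manifoldD(1)[OF N d']
  define V where "V = (fst c \<inter> snd c -` U) \<inter> (X \<inter> f -` (fst d \<inter> fst d'))"
  have "open V"
    unfolding V_def using charts X f U(1) smooth_manifoldD(2)[OF N] d d'
    by (intro open_Int open_chart_preimage continuous_open_preimage) auto
  let ?U = "snd c' ` (fst c' \<inter> V)"
  have U': "open ?U" by (rule open_chart_image[OF charts(2) \<open>open V\<close>])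
  have s1: "smooth_on ?U (snd c \<circ> chart_inv c')"
    by (rule smooth_on_subset[OF smooth_manifoldD(3)[OF M c' c]]) (auto simp: V_def)
  have s2: "smooth_on ?U ((snd d \<circ> f \<circ> chart_inv c) \<circ> (snd c \<circ> chart_inv c'))"
    by (rule smooth_on_compose[OF U' _ s1 U(3)]) (use charts in \<open>auto simp: V_def\<close>)
  have s3: "smooth_on ?U ((snd d' \<circ> chart_inv d) \<circ>
      ((snd d \<circ> f \<circ> chart_inv c) \<circ> (snd c \<circ> chart_inv c')))"
    by (rule smooth_on_compose[OF U' _ s2 smooth_manifoldD(3)[OF N d d']])
      (use charts in \<open>auto simp: V_def\<close>)
  have "smooth_on ?U (snd d' \<circ> f \<circ> chart_inv c')"
    by (rule smooth_on_cong[OF U' _ s3]) (use charts in \<open>auto simp: V_def\<close>)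
  moreover have "y \<in> ?U" using p pc U by (auto simp: V_def)
  ultimately show "\<exists>U. open U \<and> y \<in> U \<and> smooth_on U (snd d' \<circ> f \<circ> chart_inv c')"
    using U' by blast
qed

lemma smooth_map_on_representative:
  assumes "smooth_manifold M" "smooth_manifold N" "open X" "smooth_map_on M N X f"
    and "c \<in> atlas M" "d \<in> atlas N" "p \<in> X" "p \<in> fst c" "f p \<in> fst d"
  obtains V where "open V" "p \<in> V" "V \<subseteq> X \<inter> fst c \<inter> f -` fst d" "open (snd c ` V)"
    "smooth_on (snd c ` V) (snd d \<circ> f \<circ> chart_inv c)"
proof
  let ?V = "{p \<in> X \<inter> fst c. f p \<in> fst d}"
  have c: "is_chart c" and d: "open (fst d)"
    using smooth_manifoldD assms by blast+
  have f: "continuous_on X f" using assms(4) unfolding smooth_map_on_def by blast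
  have "?V = fst c \<inter> (X \<inter> f -` fst d)" by auto
  then show "open ?V"
    using open_Int[OF _ continuous_open_preimage[OF f assms(3) d]] smooth_manifoldD(2) assms by metis
  show "open (snd c ` ?V)" by (rule open_representative_domain[OF c d assms(3) f])
  show "smooth_on (snd c ` ?V) (snd d \<circ> f \<circ> chart_inv c)"
    using assms unfolding smooth_map_on_def by blast
qed (use assms in auto)

lemma smooth_map_on_imp_continuous_on: "smooth_map_on M N X f \<Longrightarrow> continuous_on X f"
  unfolding smooth_map_on_def by blast

lemma smooth_map_on_subset: "smooth_map_on M N X f \<Longrightarrow> Y \<subseteq> X \<Longrightarrow> smooth_map_on M N Y f"
  unfolding smooth_map_on_def
  by (auto intro: continuous_on_subset smooth_on_subset)

lemma smooth_map_on_compose: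
  assumes M: "smooth_manifold M" and N: "smooth_manifold N" and P: "smooth_manifold P"
    and X: "open X" and Y: "open Y" and fX: "f ` X \<subseteq> Y"
    and f: "smooth_map_on M N X f" and g: "smooth_map_on N P Y g"
  shows "smooth_map_on M P X (g \<circ> f)"
proof (rule smooth_map_onI_at[OF M P X])
  show cont: "continuous_on X (g \<circ> f)"
    using continuous_on_compose2[OF smooth_map_on_imp_continuous_on[OF g]
        smooth_map_on_imp_continuous_on[OF f] fX] by (simp add: o_def)
  fix p assume p: "p \<in> X"
  let ?c = "chart_at M p" and ?d = "chart_at N (f p)" and ?e = "chart_at P (g (f p))"
  have pc: "?c \<in> atlas M" "?d \<in> atlas N" "?e \<in> atlas P"
    "p \<in> fst ?c" "f p \<in> fst ?d" "g (f p) \<in> fst ?e"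
    by (simp_all add: smooth_manifoldD(4,5) M N P)
  obtain V where V: "open V" "p \<in> V" "V \<subseteq> X \<inter> fst ?c \<inter> f -` fst ?d"
    "smooth_on (snd ?c ` V) (snd ?d \<circ> f \<circ> chart_inv ?c)"
    using smooth_map_on_representative[OF M N X f pc(1,2) p pc(4,5)] .
  have fp: "f p \<in> Y" using p fX by blast
  obtain W where W: "open W" "f p \<in> W" "W \<subseteq> Y \<inter> fst ?d \<inter> g -` fst ?e"
    "smooth_on (snd ?d ` W) (snd ?e \<circ> g \<circ> chart_inv ?d)"
    using smooth_map_on_representative[OF N P Y g pc(2,3) fp pc(5,6)] .
  note charts = smooth_manifoldD(1)[OF M pc(1)] smooth_manifoldD(1)[OF N pc(2)]
  define V' where "V' = V \<inter> (X \<inter> f -` W)"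
  have V'o: "open V'"
    unfolding V'_def
    using V(1) continuous_open_preimage[OF smooth_map_on_imp_continuous_on[OF f] X W(1)] by auto
  have "V' = fst ?c \<inter> V'" using V(3) by (auto simp: V'_def)
  then have U: "open (snd ?c ` V')" using open_chart_image[OF charts(1) V'o] by simp
  have "smooth_on (snd ?c ` V') ((snd ?e \<circ> g \<circ> chart_inv ?d) \<circ> (snd ?d \<circ> f \<circ> chart_inv ?c))"
  proof (rule smooth_on_compose[OF U _ _ W(4)])
    show "smooth_on (snd ?c ` V') (snd ?d \<circ> f \<circ> chart_inv ?c)"
      using V(4) by (rule smooth_on_subset) (auto simp: V'_def)
    show "(snd ?d \<circ> f \<circ> chart_inv ?c) ` snd ?c ` V' \<subseteq> snd ?d ` W"
      using charts V(3) by (auto simp: V'_def)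
  qed
  then have "smooth_on (snd ?c ` V') (snd ?e \<circ> (g \<circ> f) \<circ> chart_inv ?c)"
    by (rule smooth_on_cong[OF U, rotated]) (use charts V(3) W(3) in \<open>auto simp: V'_def dest!: subsetD\<close>)
  moreover have "p \<in> V'" using V W p by (auto simp: V'_def)
  ultimately show "\<exists>c\<in>atlas M. \<exists>d\<in>atlas P. p \<in> fst c \<and> (g \<circ> f) p \<in> fst d \<and>
      (\<exists>U. open U \<and> snd c p \<in> U \<and> smooth_on U (snd d \<circ> (g \<circ> f) \<circ> chart_inv c))"
    using pc U by auto
qed

text \<open>A local formula \<open>h\<close> for the representative in the distinguished charts determines the
  differential.\<close>

lemma mderiv_eqI:
  assumes "open U" "snd (chart_at M p) p \<in> U"
    and "\<And>y. y \<in> U \<Longrightarrow> snd (chart_at N (f p)) (f (chart_inv (chart_at M p) y)) = h y"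
    and "(h has_derivative h') (at (snd (chart_at M p) p))"
  shows "mderiv M N f p = h'"
proof -
  have "(snd (chart_at N (f p)) \<circ> f \<circ> chart_inv (chart_at M p) has_derivative h')
      (at (snd (chart_at M p) p))"
    by (rule has_derivative_transform_within_open[OF assms(4,1,2)]) (simp add: assms(3))
  then show ?thesis unfolding mderiv_def using frechet_derivative_at by metis
qed

lemma mderiv_works:
  assumes M: "smooth_manifold M" and N: "smooth_manifold N" and "open X"
    and "smooth_map_on M N X f" "p \<in> X"
  shows "(snd (chart_at N (f p)) \<circ> f \<circ> chart_inv (chart_at M p) has_derivative mderiv M N f p)
    (at (snd (chart_at M p) p))"
proof -
  obtain V where "p \<in> V" "smooth_on (snd (chart_at M p) ` V)
      (snd (chart_at N (f p)) \<circ> f \<circ> chart_inv (chart_at M p))"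
    by (rule smooth_map_on_representative[OF assms(1-4) smooth_manifoldD(4)[OF M]
          smooth_manifoldD(4)[OF N] assms(5) smooth_manifoldD(5)[OF M] smooth_manifoldD(5)[OF N]])
  then show ?thesis
    unfolding mderiv_def frechet_derivative_works[symmetric]
    by (auto intro: smooth_on_imp_differentiable)
qed

lemma linear_mderiv:
  assumes "smooth_manifold M" "smooth_manifold N" "open X" "smooth_map_on M N X f" "p \<in> X"
  shows "linear (mderiv M N f p)"
  using mderiv_works[OF assms] has_derivative_linear by blast

lemma mderiv_compose:
  assumes M: "smooth_manifold M" and N: "smooth_manifold N" and P: "smooth_manifold P"
    and X: "open X" and Y: "open Y"
    and f: "smooth_map_on M N X f" and g: "smooth_map_on N P Y g"
    and p: "p \<in> X" and fp: "f p \<in> Y"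
  shows "mderiv M P (g \<circ> f) p v = mderiv N P g (f p) (mderiv M N f p v)"
proof -
  let ?c = "chart_at M p" and ?d = "chart_at N (f p)" and ?e = "chart_at P (g (f p))"
  have pc: "?c \<in> atlas M" "?d \<in> atlas N" "p \<in> fst ?c" "f p \<in> fst ?d"
    by (simp_all add: smooth_manifoldD(4,5) M N)
  note charts = smooth_manifoldD(1)[OF M pc(1)] smooth_manifoldD(1)[OF N pc(2)]
  obtain V where V: "open V" "p \<in> V" "V \<subseteq> X \<inter> fst ?c \<inter> f -` fst ?d" "open (snd ?c ` V)"
    using smooth_map_on_representative[OF M N X f pc(1,2) p pc(3,4)] .
  have dg: "(snd ?e \<circ> g \<circ> chart_inv ?d has_derivative mderiv N P g (f p))
      (at ((snd ?d \<circ> f \<circ> chart_inv ?c) (snd ?c p)))"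
    using mderiv_works[OF N P Y g fp] charts pc by simp
  have "mderiv M P (g \<circ> f) p = mderiv N P g (f p) \<circ> mderiv M N f p"
  proof (rule mderiv_eqI[OF V(4)])
    show "snd ?c p \<in> snd ?c ` V" using V(2) by simp
    show "((snd ?e \<circ> g \<circ> chart_inv ?d) \<circ> (snd ?d \<circ> f \<circ> chart_inv ?c) has_derivative
        mderiv N P g (f p) \<circ> mderiv M N f p) (at (snd ?c p))"
      by (rule diff_chain_at[OF mderiv_works[OF M N X f p] dg])
    show "snd (chart_at P ((g \<circ> f) p)) ((g \<circ> f) (chart_inv ?c y)) =
        ((snd ?e \<circ> g \<circ> chart_inv ?d) \<circ> (snd ?d \<circ> f \<circ> chart_inv ?c)) y"
      if "y \<in> snd ?c ` V" for y
      using that V(3) charts by (auto dest!: subsetD)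
  qed
  then show ?thesis by simp
qed

lemma mderiv_id:
  assumes "smooth_manifold M"
  shows "mderiv M M (\<lambda>q. q) p = id"
proof -
  let ?c = "chart_at M p"
  have c: "is_chart ?c" "p \<in> fst ?c" by (simp_all add: smooth_manifoldD(1,4,5)[OF assms])
  show ?thesis
    by (rule mderiv_eqI[where U = "snd ?c ` fst ?c" and h = id])
      (use c in \<open>auto simp: is_chart_def\<close>)
qed

lemma mderiv_cong:
  assumes M: "smooth_manifold M" and N: "smooth_manifold N" and "open X"
    and "smooth_map_on M N X f" "p \<in> X" and eq: "\<And>q. q \<in> X \<Longrightarrow> g q = f q"
  shows "mderiv M N g p = mderiv M N f p"
proof -
  let ?c = "chart_at M p"
  have c: "is_chart ?c" "p \<in> fst ?c" by (simp_all add: smooth_manifoldD(1,4,5)[OF M])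
  show ?thesis
    by (rule mderiv_eqI[OF open_chart_image[OF c(1) \<open>open X\<close>] _ _ mderiv_works[OF assms(1-5)]])
      (use c assms in auto)
qed

text \<open>The chain rule for two maps that undo each other. As they may be defined on open subsets only,
  this applies to charts as well as to diffeomorphisms.\<close>

lemma mderiv_left_inverse:
  assumes M: "smooth_manifold M" and N: "smooth_manifold N" and X: "open X" and Y: "open Y"
    and f: "smooth_map_on M N X f" and g: "smooth_map_on N M Y g"
    and fX: "f ` X \<subseteq> Y" and inv: "\<And>q. q \<in> X \<Longrightarrow> g (f q) = q" and p: "p \<in> X"
  shows "mderiv N M g (f p) (mderiv M N f p v) = v"
proof -
  have gf: "smooth_map_on M M X (g \<circ> f)" by (rule smooth_map_on_compose[OF M N M X Y fX f g])
  have "mderiv N M g (f p) (mderiv M N f p v) = mderiv M M (g \<circ> f) p v"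
    using mderiv_compose[OF M N M X Y f g p] fX p by auto
  also have "\<dots> = mderiv M M (\<lambda>q. q) p v"
    using mderiv_cong[OF M M X gf p, of "\<lambda>q. q"] inv by simp
  finally show ?thesis using mderiv_id[OF M] by simp
qed

subsection \<open>Euclidean spaces\<close>

lemma chart_inv_UNIV_id [simp]: "chart_inv (UNIV, id) = id"
  unfolding chart_inv_def by simp

lemma euclid_simps [simp]:
  "atlas euclid = {(UNIV, id)}" "chart_at euclid p = (UNIV, id)"
  unfolding euclid_def by auto

lemma smooth_manifold_euclid: "smooth_manifold euclid"
proof -
  have "smooth_on UNIV (id :: 'a \<Rightarrow> 'a)"
    using smooth_on_linear[OF bounded_linear_ident] by (simp add: id_def)
  then show ?thesis
    unfolding smooth_manifold_def is_chart_def homeomorphism_def by auto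
qed

lemma smooth_map_on_euclid_iff: "smooth_map_on euclid euclid X f \<longleftrightarrow> smooth_on X f"
  unfolding smooth_map_on_def using smooth_on_imp_continuous_on by (auto simp: Ball_def)

lemma mderiv_euclid: "mderiv euclid euclid f p = frechet_derivative f (at p)"
  unfolding mderiv_def by simp

lemma smooth_map_on_chart:
  assumes "smooth_manifold M" "c \<in> atlas M"
  shows "smooth_map_on M euclid (fst c) (snd c)"
  unfolding smooth_map_on_def
proof (intro conjI ballI)
  have c: "is_chart c" using smooth_manifoldD assms by blast
  then show "continuous_on (fst c) (snd c)"
    unfolding is_chart_def homeomorphism_def by blast
  fix c' and d :: "('b, 'b) chart" assume c': "c' \<in> atlas M" and "d \<in> atlas euclid"
  then have d: "d = (UNIV, id)" by simp
  have "{p \<in> fst c \<inter> fst c'. snd c p \<in> fst d} = fst c' \<inter> fst c" by (auto simp: d)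
  then show "smooth_on (snd c' ` {p \<in> fst c \<inter> fst c'. snd c p \<in> fst d})
      (snd d \<circ> snd c \<circ> chart_inv c')"
    using smooth_manifoldD(3)[OF assms(1) c' assms(2)] by (simp add: d)
qed

lemma smooth_map_on_chart_inv:
  assumes "smooth_manifold M" "c \<in> atlas M"
  shows "smooth_map_on euclid M (snd c ` fst c) (chart_inv c)"
  unfolding smooth_map_on_def
proof (intro conjI ballI)
  have c: "is_chart c" using smooth_manifoldD assms by blast
  then show "continuous_on (snd c ` fst c) (chart_inv c)"
    unfolding is_chart_def homeomorphism_def by blast
  fix c' :: "('b, 'b) chart" and d assume "c' \<in> atlas euclid" and d: "d \<in> atlas M"
  then have c': "c' = (UNIV, id)" by simp
  show "smooth_on (snd c' ` {p \<in> snd c ` fst c \<inter> fst c'. chart_inv c p \<in> fst d})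
      (snd d \<circ> chart_inv c \<circ> chart_inv c')"
    unfolding c' using c
    by (auto intro!: smooth_on_subset[OF smooth_manifoldD(3)[OF assms d]])
qed

lemma open_chart_range:
  assumes "smooth_manifold M" "c \<in> atlas M"
  shows "open (snd c ` fst c)"
  using smooth_manifoldD(1)[OF assms] unfolding is_chart_def by blast

lemma mderiv_chart_inverse:
  assumes M: "smooth_manifold M" and c: "c \<in> atlas M" and p: "p \<in> fst c"
  shows "mderiv euclid M (chart_inv c) (snd c p) (mderiv M euclid (snd c) p v) = v"
  using smooth_manifoldD(1)[OF M c]
  by (intro mderiv_left_inverse[OF M smooth_manifold_euclid smooth_manifoldD(2)[OF M c]
        open_chart_range[OF M c] smooth_map_on_chart[OF M c] smooth_map_on_chart_inv[OF M c] _ _ p])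
    auto

section \<open>The product with a line\<close>

lemma fst_times_line_chart [simp]: "fst (times_line_chart c) = fst c \<times> UNIV"
  unfolding times_line_chart_def by simp

lemma snd_times_line_chart [simp]: "snd (times_line_chart c) z = (snd c (fst z), snd z)"
  unfolding times_line_chart_def by (simp add: case_prod_beta)

lemma times_line_chart_image [simp]:
  "(\<lambda>z. (snd c (fst z), snd z :: real)) ` (A \<times> UNIV) = (snd c ` A) \<times> UNIV"
  by force

lemma chart_inv_times_line:
  assumes "inj_on (snd c) (fst c)" "fst y \<in> snd c ` fst c"
  shows "chart_inv (times_line_chart c) y = (chart_inv c (fst y), snd y)"
  unfolding chart_inv_def
proof (rule inv_into_f_eq)
  show "inj_on (snd (times_line_chart c)) (fst (times_line_chart c))"
    using assms(1) by (auto simp: inj_on_def)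
qed (use assms in \<open>auto simp: inv_into_into f_inv_into_f\<close>)

lemma is_chart_times_line:
  assumes "is_chart c"
  shows "is_chart (times_line_chart c)"
proof -
  have inj: "inj_on (snd c) (fst c)" and c: "homeomorphism (fst c) (snd c ` fst c) (snd c) (chart_inv c)"
    using assms unfolding is_chart_def by auto
  note cont = homeomorphism_cont1[OF c] homeomorphism_cont2[OF c]
  have inv: "chart_inv (times_line_chart c) y = (chart_inv c (fst y), snd y)"
    if "y \<in> (snd c ` fst c) \<times> UNIV" for y
    using chart_inv_times_line[OF inj] that by auto
  have "continuous_on (fst c \<times> UNIV) (\<lambda>z. (snd c (fst z), snd z :: real))"
    by (intro continuous_intros continuous_on_compose2[OF cont(1)]) auto
  then have c1: "continuous_on (fst c \<times> UNIV) (snd (times_line_chart c))"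
    by (simp cong: continuous_on_cong)
  have "continuous_on ((snd c ` fst c) \<times> UNIV) (\<lambda>z. (chart_inv c (fst z), snd z :: real))"
    by (intro continuous_intros continuous_on_compose2[OF cont(2)]) auto
  then have c2: "continuous_on ((snd c ` fst c) \<times> UNIV) (chart_inv (times_line_chart c))"
    using inv by (simp cong: continuous_on_cong)
  have "homeomorphism (fst c \<times> UNIV) ((snd c ` fst c) \<times> UNIV)
      (snd (times_line_chart c)) (chart_inv (times_line_chart c))"
    by (rule homeomorphismI[OF c1 c2]) (use inv assms in auto)
  moreover have "inj_on (snd (times_line_chart c)) (fst c \<times> UNIV)"
    using inj by (auto simp: inj_on_def)
  ultimately show ?thesis
    using assms unfolding is_chart_def by (auto intro: open_Times)
qed

lemma times_line_simps [simp]: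
  "atlas (times_line S) = times_line_chart ` atlas S"
  "chart_at (times_line S) z = times_line_chart (chart_at S (fst z))"
  unfolding times_line_def by auto

lemma smooth_manifold_times_line:
  assumes S: "smooth_manifold S"
  shows "smooth_manifold (times_line S)"
proof -
  have "smooth_on (snd (times_line_chart c) ` (fst (times_line_chart c) \<inter> fst (times_line_chart d)))
      (snd (times_line_chart d) \<circ> chart_inv (times_line_chart c))"
    if c: "c \<in> atlas S" and d: "d \<in> atlas S" for c d
  proof -
    let ?U = "(snd c ` (fst c \<inter> fst d)) \<times> (UNIV :: real set)"
    note charts = smooth_manifoldD(1)[OF S c] smooth_manifoldD(1)[OF S d]
    have U: "open ?U"
      using open_chart_image[OF charts(1) smooth_manifoldD(2)[OF S d]] by (intro open_Times) auto
    have "smooth_on ?U ((snd d \<circ> chart_inv c) \<circ> fst)"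
      by (rule smooth_on_compose[OF U _ smooth_on_linear[OF bounded_linear_fst]
            smooth_manifoldD(3)[OF S c d]]) auto
    then have "smooth_on ?U (\<lambda>y. (((snd d \<circ> chart_inv c) \<circ> fst) y, snd y))"
      by (intro smooth_on_Pair U smooth_on_linear[OF bounded_linear_snd])
    then have "smooth_on ?U (snd (times_line_chart d) \<circ> chart_inv (times_line_chart c))"
      by (rule smooth_on_cong[OF U, rotated])
        (use charts in \<open>auto simp: chart_inv_times_line is_chart_def\<close>)
    moreover have "fst (times_line_chart c) \<inter> fst (times_line_chart d) =
        (fst c \<inter> fst d) \<times> (UNIV :: real set)"
      by auto
    ultimately show ?thesis by simp
  qed
  then show ?thesis
    unfolding smooth_manifold_def
    using smooth_manifoldD[OF S] by (auto intro: is_chart_times_line)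
qed

text \<open>For maps that are affine in distinguished charts, such as the projections and slices of
  \<open>S \<times> \<real>\<close>: the formula \<open>h p\<close> may depend on the point, but its linear part \<open>h'\<close> does not.\<close>

lemma smooth_map_mderiv_eqI:
  assumes M: "smooth_manifold M" and N: "smooth_manifold N" and f: "continuous_on UNIV f"
    and rep: "\<And>p y. y \<in> snd (chart_at M p) ` fst (chart_at M p) \<Longrightarrow>
      snd (chart_at N (f p)) (f (chart_inv (chart_at M p) y)) = h p y"
    and h: "\<And>p. smooth_on UNIV (h p)" "\<And>p y. (h p has_derivative h') (at y)"
  shows "smooth_map M N f" and "mderiv M N f p = h'"
proof -
  have op: "open (snd (chart_at M p) ` fst (chart_at M p))" for p
    by (rule open_chart_range[OF M smooth_manifoldD(4)[OF M]])
  have mem: "snd (chart_at M p) p \<in> snd (chart_at M p) ` fst (chart_at M p)" for p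
    using smooth_manifoldD(5)[OF M] by blast
  show "smooth_map M N f"
  proof (rule smooth_map_onI_at[OF M N open_UNIV f])
    fix p
    have "smooth_on (snd (chart_at M p) ` fst (chart_at M p))
        (snd (chart_at N (f p)) \<circ> f \<circ> chart_inv (chart_at M p))"
      by (rule smooth_on_cong[OF op _ smooth_on_subset[OF h(1) subset_UNIV]]) (simp add: rep)
    then show "\<exists>c\<in>atlas M. \<exists>d\<in>atlas N. p \<in> fst c \<and> f p \<in> fst d \<and>
      (\<exists>U. open U \<and> snd c p \<in> U \<and> smooth_on U (snd d \<circ> f \<circ> chart_inv c))"
      using smooth_manifoldD(4,5)[OF M] smooth_manifoldD(4,5)[OF N] op mem by metis
  qed
  show "mderiv M N f p = h'"
    by (rule mderiv_eqI[OF op mem rep h(2)])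
qed

context
  fixes S :: "('s::{t2_space,second_countable_topology}, 'f::euclidean_space) mfd"
  assumes S: "smooth_manifold S"
begin

lemma chart_at_S: "is_chart (chart_at S x)" "inj_on (snd (chart_at S x)) (fst (chart_at S x))"
    "x \<in> fst (chart_at S x)"
  using smooth_manifoldD(1)[OF S smooth_manifoldD(4)[OF S]] smooth_manifoldD(5)[OF S]
  by (auto simp: is_chart_def)

lemma smooth_map_fst: "smooth_map (times_line S) S fst"
  and mderiv_fst: "mderiv (times_line S) S fst z = fst"
proof -
  have rep: "snd (chart_at S (fst p)) (fst (chart_inv (chart_at (times_line S) p) y)) = fst y"
    if "y \<in> snd (chart_at (times_line S) p) ` fst (chart_at (times_line S) p)" for p y
    using that chart_at_S by (auto simp: chart_inv_times_line)
  note * = smooth_map_mderiv_eqI[OF smooth_manifold_times_line[OF S] S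
      continuous_on_fst[OF continuous_on_id] rep smooth_on_linear[OF bounded_linear_fst]
      bounded_linear_imp_has_derivative[OF bounded_linear_fst]]
  show "smooth_map (times_line S) S fst" using *(1) by simp
  show "mderiv (times_line S) S fst z = fst" using *(2) by simp
qed

lemma smooth_map_snd: "smooth_map (times_line S) euclid snd"
  and mderiv_snd: "mderiv (times_line S) euclid snd z = snd"
proof -
  have rep: "snd (chart_at euclid (snd p)) (snd (chart_inv (chart_at (times_line S) p) y)) = snd y"
    if "y \<in> snd (chart_at (times_line S) p) ` fst (chart_at (times_line S) p)" for p y
    using that chart_at_S by (auto simp: chart_inv_times_line)
  note * = smooth_map_mderiv_eqI[OF smooth_manifold_times_line[OF S] smooth_manifold_euclid
      continuous_on_snd[OF continuous_on_id] rep smooth_on_linear[OF bounded_linear_snd]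
      bounded_linear_imp_has_derivative[OF bounded_linear_snd]]
  show "smooth_map (times_line S) euclid snd" using *(1) by simp
  show "mderiv (times_line S) euclid snd z = snd" using *(2) by simp
qed

lemma smooth_map_slice: "smooth_map S (times_line S) (\<lambda>x. (x, t))"
  and mderiv_slice: "mderiv S (times_line S) (\<lambda>x. (x, t)) x = (\<lambda>v. (v, 0))"
proof -
  have rep: "snd (chart_at (times_line S) (p, t)) (chart_inv (chart_at S p) y, t) = (y, t)"
    if "y \<in> snd (chart_at S p) ` fst (chart_at S p)" for p y
    using that chart_at_S by auto
  note * = smooth_map_mderiv_eqI[OF S smooth_manifold_times_line[OF S]
      continuous_on_Pair[OF continuous_on_id continuous_on_const] rep
      smooth_on_Pair[OF open_UNIV smooth_on_linear[OF bounded_linear_ident] smooth_on_const]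
      has_derivative_Pair[OF has_derivative_ident has_derivative_const]]
  show "smooth_map S (times_line S) (\<lambda>x. (x, t))" by (rule *(1))
  show "mderiv S (times_line S) (\<lambda>x. (x, t)) x = (\<lambda>v. (v, 0))" by (rule *(2))
qed

lemma smooth_map_line: "smooth_map euclid (times_line S) (\<lambda>t. (x, t))"
  and mderiv_line: "mderiv euclid (times_line S) (\<lambda>t. (x, t)) t = (\<lambda>\<tau>. (0, \<tau>))"
proof -
  have rep: "snd (chart_at (times_line S) (x, p)) (x, chart_inv (chart_at euclid p) t) =
      (snd (chart_at S x) x, t)" for p t
    by simp
  note * = smooth_map_mderiv_eqI[OF smooth_manifold_euclid smooth_manifold_times_line[OF S]
      continuous_on_Pair[OF continuous_on_const continuous_on_id] rep
      smooth_on_Pair[OF open_UNIV smooth_on_const smooth_on_linear[OF bounded_linear_ident]]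
      has_derivative_Pair[OF has_derivative_const has_derivative_ident]]
  show "smooth_map euclid (times_line S) (\<lambda>t. (x, t))" by (rule *(1))
  show "mderiv euclid (times_line S) (\<lambda>t. (x, t)) t = (\<lambda>\<tau>. (0, \<tau>))" by (rule *(2))
qed

end

section \<open>Velocities\<close>

lemma velocity_compose:
  assumes "smooth_manifold M" "smooth_manifold N" "open J" "open X"
    and "smooth_map_on euclid M J \<delta>" "smooth_map_on M N X f" "s \<in> J" "\<delta> s \<in> X"
  shows "velocity N (f \<circ> \<delta>) s = mderiv M N f (\<delta> s) (velocity M \<delta> s)"
  unfolding velocity_def using mderiv_compose[OF smooth_manifold_euclid assms] .

lemma velocity_euclid:
  assumes "open J" "smooth_map_on euclid euclid J h" "s \<in> J"
  shows "(h has_vector_derivative velocity euclid h s) (at s)"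
proof -
  have d: "h differentiable (at s)"
    using assms smooth_on_imp_differentiable smooth_map_on_euclid_iff by blast
  have "(\<lambda>r. r *\<^sub>R frechet_derivative h (at s) 1) = frechet_derivative h (at s)"
  proof
    fix r show "r *\<^sub>R frechet_derivative h (at s) 1 = frechet_derivative h (at s) r"
      using linear_cmul[OF linear_frechet_derivative[OF d], of r 1] by simp
  qed
  moreover have "(h has_derivative frechet_derivative h (at s)) (at s)"
    using d by (simp flip: frechet_derivative_works)
  ultimately show ?thesis
    unfolding velocity_def mderiv_euclid has_vector_derivative_def by (simp only:)
qed

text \<open>In a chart around any of its points, the curve has derivative zero, so it is locally constant.\<close>

lemma constant_if_velocity_zero:
  fixes M :: "('m::{t2_space,second_countable_topology}, 'e::euclidean_space) mfd"
  assumes M: "smooth_manifold M" and \<eta>: "smooth_map euclid M \<eta>" and vel: "\<And>s. velocity M \<eta> s = 0"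
  shows "\<eta> s = \<eta> t"
proof (rule connected_local_const[of UNIV s t \<eta>])
  show "\<forall>a\<in>UNIV. \<forall>\<^sub>F b in at a within UNIV. \<eta> a = \<eta> b"
  proof
    fix a
    let ?c = "chart_at M (\<eta> a)"
    have c: "?c \<in> atlas M" "\<eta> a \<in> fst ?c" by (simp_all add: smooth_manifoldD(4,5)[OF M])
    let ?V = "\<eta> -` fst ?c"
    have V: "open ?V"
      using continuous_open_preimage[OF smooth_map_on_imp_continuous_on[OF \<eta>] open_UNIV
          smooth_manifoldD(2)[OF M c(1)]] by simp
    have chart: "smooth_map_on M euclid (fst ?c) (snd ?c)" by (rule smooth_map_on_chart[OF M c(1)])
    have \<eta>V: "smooth_map_on euclid M ?V \<eta>" using \<eta> smooth_map_on_subset by blast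
    have s: "smooth_map_on euclid euclid ?V (snd ?c \<circ> \<eta>)"
      by (rule smooth_map_on_compose[OF smooth_manifold_euclid M smooth_manifold_euclid V
            smooth_manifoldD(2)[OF M c(1)] _ \<eta>V chart]) auto
    have d: "(snd ?c \<circ> \<eta> has_derivative (\<lambda>h. 0)) (at b)" if "b \<in> ?V" for b
    proof -
      have "velocity euclid (snd ?c \<circ> \<eta>) b = mderiv M euclid (snd ?c) (\<eta> b) 0"
        using velocity_compose[OF M smooth_manifold_euclid V smooth_manifoldD(2)[OF M c(1)] \<eta>V chart that]
          that vel by simp
      also have "\<dots> = 0"
        using linear_0[OF linear_mderiv[OF M smooth_manifold_euclid smooth_manifoldD(2)[OF M c(1)] chart]]
          that by simp
      finally show ?thesis
        using velocity_euclid[OF V s that] by (simp add: has_vector_derivative_def)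
    qed
    obtain e where e: "e > 0" "ball a e \<subseteq> ?V" using V c(2) openE by blast
    have "\<eta> a = \<eta> b" if b: "b \<in> ball a e" for b
    proof -
      have "(snd ?c \<circ> \<eta>) a = (snd ?c \<circ> \<eta>) b"
        by (rule has_derivative_zero_unique[OF convex_ball has_derivative_at_withinI[OF d]])
          (use e b in auto)
      moreover have "b \<in> ?V" using b e by blast
      ultimately show ?thesis
        using c smooth_manifoldD(1)[OF M c(1)] unfolding is_chart_def inj_on_def by simp
    qed
    then show "\<forall>\<^sub>F b in at a within UNIV. \<eta> a = \<eta> b"
      by (intro eventually_mono[OF eventually_at_ball[OF e(1)]]) blast
  qed
qed auto

text \<open>A map that preserves the coordinate field of the line factor maps the lines \<open>{x} \<times> \<real>\<close> to
  integral curves of that field. The component of such a curve in \<open>S'\<close> has velocity \<open>0\<close>, and its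
  real component has derivative \<open>1\<close>.\<close>

lemma translation_equivariant:
  assumes S: "smooth_manifold S" and S': "smooth_manifold S'"
    and G: "smooth_map (times_line S) (times_line S') G"
    and field: "\<And>z. mderiv (times_line S) (times_line S') G z (0, 1) = (0, 1)"
  shows "G (x, t) = (fst (G (x, 0)), t + snd (G (x, 0)))"
proof -
  note L = smooth_manifold_times_line[OF S] and L' = smooth_manifold_times_line[OF S']
  note E = smooth_manifold_euclid
  let ?\<gamma> = "G \<circ> (\<lambda>t. (x, t))"
  have \<gamma>: "smooth_map euclid (times_line S') ?\<gamma>"
    by (rule smooth_map_on_compose[OF E L L' open_UNIV open_UNIV _ smooth_map_line[OF S] G]) simp
  have vel: "velocity (times_line S') ?\<gamma> s = (0, 1)" for s
  proof -
    have "velocity (times_line S) (\<lambda>t. (x, t)) s = (0, 1)"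
      by (simp add: velocity_def mderiv_line[OF S])
    then show ?thesis
      using velocity_compose[OF L L' open_UNIV open_UNIV smooth_map_line[OF S] G] field by simp
  qed
  have "smooth_map euclid S' (fst \<circ> ?\<gamma>)"
    by (rule smooth_map_on_compose[OF E L' S' open_UNIV open_UNIV _ \<gamma> smooth_map_fst[OF S']]) simp
  moreover have "velocity S' (fst \<circ> ?\<gamma>) s = 0" for s
    using velocity_compose[OF L' S' open_UNIV open_UNIV \<gamma> smooth_map_fst[OF S']] vel
    by (simp add: mderiv_fst[OF S'])
  ultimately have "(fst \<circ> ?\<gamma>) t = (fst \<circ> ?\<gamma>) 0"
    by (rule constant_if_velocity_zero[OF S'])
  moreover have "snd (?\<gamma> t) - t = snd (?\<gamma> 0) - 0"
  proof (rule has_derivative_zero_unique[OF convex_UNIV, where f = "\<lambda>t. snd (?\<gamma> t) - t"])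
    fix s
    have "smooth_map euclid euclid (snd \<circ> ?\<gamma>)"
      by (rule smooth_map_on_compose[OF E L' E open_UNIV open_UNIV _ \<gamma> smooth_map_snd[OF S']]) simp
    moreover have "velocity euclid (snd \<circ> ?\<gamma>) s = 1"
      using velocity_compose[OF L' E open_UNIV open_UNIV \<gamma> smooth_map_snd[OF S']] vel
      by (simp add: mderiv_snd[OF S'])
    ultimately have "((\<lambda>t. snd (?\<gamma> t)) has_derivative (\<lambda>h. h)) (at s)"
      using velocity_euclid[OF open_UNIV, of "snd \<circ> ?\<gamma>" s]
      by (simp add: has_vector_derivative_def o_def)
    then show "((\<lambda>t. snd (?\<gamma> t) - t) has_derivative (\<lambda>h. 0)) (at s)"
      by (auto intro!: derivative_eq_intros)
  qed auto
  ultimately show ?thesis by (simp add: prod_eq_iff)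
qed

section \<open>Fermat metrics under change of splitting\<close>

text \<open>The Fermat metric is the larger root \<open>\<tau>\<close> of \<open>g\<^sub>0(v,v) + 2 \<omega>(v) \<tau> - \<tau>\<^sup>2\<close>, the time that a
  future-pointing lightlike vector spends above \<open>v\<close>. If two such polynomials agree up to a
  constant factor and a translation by \<open>k\<close>, then their larger roots differ by \<open>k\<close>.\<close>

lemma fermat_metric_translate:
  assumes "A > 0"
    and eq: "\<And>\<tau>. A * (g2 x u u + 2 * \<omega>2 x u * (\<tau> + k) - (\<tau> + k)\<^sup>2) =
      B * (g1 y v v + 2 * \<omega>1 y v * \<tau> - \<tau>\<^sup>2)"
  shows "fermat_metric g2 \<omega>2 x u = fermat_metric g1 \<omega>1 y v + (k::real)"
proof -
  \<comment> \<open>The values at \<open>0\<close>, \<open>1\<close> and \<open>- 1\<close> determine the coefficients of a quadratic polynomial.\<close>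
  have e: "A * (g2 x u u + 2 * \<omega>2 x u * k - k\<^sup>2) = B * g1 y v v"
    "A * (g2 x u u + 2 * \<omega>2 x u * (1 + k) - (1 + k)\<^sup>2) = B * (g1 y v v + 2 * \<omega>1 y v - 1)"
    "A * (g2 x u u + 2 * \<omega>2 x u * (- 1 + k) - (- 1 + k)\<^sup>2) = B * (g1 y v v - 2 * \<omega>1 y v - 1)"
    using eq[of 0] eq[of 1] eq[of "-1"] by simp_all
  have AB: "A = B" using e by (simp add: power2_eq_square algebra_simps)
  have w: "\<omega>2 x u = \<omega>1 y v + k"
  proof -
    have "A * (4 * \<omega>2 x u - 4 * k) = A * (4 * \<omega>1 y v)"
      using e AB by (simp add: power2_eq_square algebra_simps)
    then show ?thesis using \<open>A > 0\<close> by simp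
  qed
  have "g2 x u u + 2 * \<omega>2 x u * k - k\<^sup>2 = g1 y v v" using e(1) AB \<open>A > 0\<close> by simp
  then have "g2 x u u + (\<omega>2 x u)\<^sup>2 = g1 y v v + (\<omega>1 y v)\<^sup>2"
    by (simp add: w power2_eq_square algebra_simps)
  then show ?thesis using w by (simp add: fermat_metric_def)
qed

section \<open>Curves\<close>

lemma continuous_on_linear_family:
  fixes u :: "'a::topological_space \<Rightarrow> 'b::euclidean_space"
    and L :: "'a \<Rightarrow> 'b \<Rightarrow> 'c::real_normed_vector"
  assumes "\<And>b. continuous_on J (\<lambda>s. L s b)" "\<And>s. s \<in> J \<Longrightarrow> linear (L s)" "continuous_on J u"
  shows "continuous_on J (\<lambda>s. L s (u s))"
proof -
  have "continuous_on J (\<lambda>s. \<Sum>b\<in>Basis. (u s \<bullet> b) *\<^sub>R L s b)"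
    by (intro continuous_intros assms)
  moreover have "(\<Sum>b\<in>Basis. (u s \<bullet> b) *\<^sub>R L s b) = L s (u s)" if "s \<in> J" for s
  proof -
    interpret linear "L s" using assms(2) that .
    show ?thesis
      by (subst (3) euclidean_representation[symmetric]) (simp add: sum scale)
  qed
  ultimately show ?thesis by (simp cong: continuous_on_cong)
qed

text \<open>The velocity of a curve is represented in the distinguished charts along the curve, and
  these may jump. In one fixed chart, its coordinates \<open>u\<close> become continuous.\<close>

lemma velocity_in_chart:
  fixes S :: "('s::{t2_space,second_countable_topology}, 'f::euclidean_space) mfd"
  assumes S: "smooth_manifold S" and J: "open J" and \<delta>: "smooth_map_on euclid S J \<delta>"
    and s\<^sub>0: "s\<^sub>0 \<in> J"
  obtains c V u where "c \<in> atlas S" "open V" "s\<^sub>0 \<in> V" "V \<subseteq> J" "\<forall>s\<in>V. \<delta> s \<in> fst c"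
    "continuous_on V (snd c \<circ> \<delta>)" "continuous_on V u"
    "\<forall>s\<in>V. velocity S \<delta> s = mderiv euclid S (chart_inv c) (snd c (\<delta> s)) (u s)"
proof
  let ?c = "chart_at S (\<delta> s\<^sub>0)"
  let ?V = "J \<inter> \<delta> -` fst ?c" and ?u = "velocity euclid (snd ?c \<circ> \<delta>)"
  show c: "?c \<in> atlas S" by (rule smooth_manifoldD(4)[OF S])
  have V: "open ?V"
    by (rule continuous_open_preimage[OF smooth_map_on_imp_continuous_on[OF \<delta>] J
          smooth_manifoldD(2)[OF S c]])
  then show "open ?V" .
  show "s\<^sub>0 \<in> ?V" using s\<^sub>0 smooth_manifoldD(5)[OF S] by simp
  have \<delta>V: "smooth_map_on euclid S ?V \<delta>" using \<delta> by (rule smooth_map_on_subset) simp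
  note fc = smooth_manifoldD(2)[OF S c] and chart = smooth_map_on_chart[OF S c]
  have sm: "smooth_on ?V (snd ?c \<circ> \<delta>)"
    using smooth_map_on_compose[OF smooth_manifold_euclid S smooth_manifold_euclid V fc _ \<delta>V chart]
    by (auto simp: smooth_map_on_euclid_iff)
  show "continuous_on ?V (snd ?c \<circ> \<delta>)" using sm by (rule smooth_on_imp_continuous_on)
  show "continuous_on ?V ?u"
    using smooth_on_imp_continuous_derivative[OF sm] by (simp add: velocity_def mderiv_euclid)
  show "\<forall>s\<in>?V. velocity S \<delta> s = mderiv euclid S (chart_inv ?c) (snd ?c (\<delta> s)) (?u s)"
    using velocity_compose[OF S smooth_manifold_euclid V fc \<delta>V chart]
      mderiv_chart_inverse[OF S c] by simp
qed auto

lemma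
  fixes S :: "('s::{t2_space,second_countable_topology}, 'f::euclidean_space) mfd"
  assumes S: "smooth_manifold S" and J: "open J" and \<delta>: "smooth_map_on euclid S J \<delta>"
  shows continuous_on_one_form_velocity:
      "one_form S \<omega> \<Longrightarrow> continuous_on J (\<lambda>s. \<omega> (\<delta> s) (velocity S \<delta> s))"
    and continuous_on_sym_tensor_velocity:
      "sym_tensor S h \<Longrightarrow> continuous_on J (\<lambda>s. h (\<delta> s) (velocity S \<delta> s) (velocity S \<delta> s))"
proof -
  have "isCont (\<lambda>s. \<omega> (\<delta> s) (velocity S \<delta> s)) s\<^sub>0" if \<omega>: "one_form S \<omega>" and s\<^sub>0: "s\<^sub>0 \<in> J" for s\<^sub>0
  proof -
    obtain c V u where c: "c \<in> atlas S" and V: "open V" "s\<^sub>0 \<in> V" "V \<subseteq> J"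
      and in_c: "\<forall>s\<in>V. \<delta> s \<in> fst c"
      and cont: "continuous_on V (snd c \<circ> \<delta>)" "continuous_on V u"
      and vel: "\<forall>s\<in>V. velocity S \<delta> s = mderiv euclid S (chart_inv c) (snd c (\<delta> s)) (u s)"
      using velocity_in_chart[OF S J \<delta> s\<^sub>0] .
    note lin = linear_mderiv[OF smooth_manifold_euclid S open_chart_range[OF S c]
        smooth_map_on_chart_inv[OF S c]]
    have "continuous_on V (\<lambda>s. covector_coord S c \<omega> ((snd c \<circ> \<delta>) s) (u s))"
    proof (rule continuous_on_linear_family[OF _ _ cont(2)])
      fix b
      have "continuous_on (snd c ` fst c) (\<lambda>y. covector_coord S c \<omega> y b)"
        using \<omega> c unfolding one_form_def by (auto intro: smooth_on_imp_continuous_on)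
      then show "continuous_on V (\<lambda>s. covector_coord S c \<omega> ((snd c \<circ> \<delta>) s) b)"
        by (rule continuous_on_compose2[OF _ cont(1)]) (use in_c in auto)
    next
      fix s assume "s \<in> V"
      then have "linear (mderiv euclid S (chart_inv c) ((snd c \<circ> \<delta>) s))"
        using in_c lin by simp
      moreover have "linear (\<omega> (chart_inv c ((snd c \<circ> \<delta>) s)))"
        using \<omega> by (simp add: one_form_def)
      ultimately show "linear (covector_coord S c \<omega> ((snd c \<circ> \<delta>) s))"
        unfolding covector_coord_def using linear_compose by (simp add: o_def)
    qed
    moreover have "covector_coord S c \<omega> ((snd c \<circ> \<delta>) s) (u s) = \<omega> (\<delta> s) (velocity S \<delta> s)"
      if "s \<in> V" for s
      using that vel in_c smooth_manifoldD(1)[OF S c] by (simp add: covector_coord_def)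
    ultimately have "continuous_on V (\<lambda>s. \<omega> (\<delta> s) (velocity S \<delta> s))"
      by (simp cong: continuous_on_cong)
    then show ?thesis using V by (simp add: continuous_on_eq_continuous_at)
  qed
  then show "one_form S \<omega> \<Longrightarrow> continuous_on J (\<lambda>s. \<omega> (\<delta> s) (velocity S \<delta> s))"
    by (simp add: continuous_at_imp_continuous_on)
  have "isCont (\<lambda>s. h (\<delta> s) (velocity S \<delta> s) (velocity S \<delta> s)) s\<^sub>0"
    if h: "sym_tensor S h" and s\<^sub>0: "s\<^sub>0 \<in> J" for s\<^sub>0
  proof -
    obtain c V u where c: "c \<in> atlas S" and V: "open V" "s\<^sub>0 \<in> V" "V \<subseteq> J"
      and in_c: "\<forall>s\<in>V. \<delta> s \<in> fst c"
      and cont: "continuous_on V (snd c \<circ> \<delta>)" "continuous_on V u"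
      and vel: "\<forall>s\<in>V. velocity S \<delta> s = mderiv euclid S (chart_inv c) (snd c (\<delta> s)) (u s)"
      using velocity_in_chart[OF S J \<delta> s\<^sub>0] .
    note lin = linear_mderiv[OF smooth_manifold_euclid S open_chart_range[OF S c]
        smooth_map_on_chart_inv[OF S c]]
    have lin1: "linear (\<lambda>a. bilin_coord S c h ((snd c \<circ> \<delta>) s) a b)"
      and lin2: "linear (\<lambda>a. bilin_coord S c h ((snd c \<circ> \<delta>) s) b a)" if "s \<in> V" for s b
    proof -
      have h1: "linear (\<lambda>v. h p v w)" and h2: "linear (\<lambda>v. h p w v)" for p w
        using h unfolding sym_tensor_def bilinear_def by auto
      have L: "linear (mderiv euclid S (chart_inv c) ((snd c \<circ> \<delta>) s))"
        using that in_c lin by simp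
      show "linear (\<lambda>a. bilin_coord S c h ((snd c \<circ> \<delta>) s) a b)"
        unfolding bilin_coord_def using linear_compose[OF L h1] by (simp add: o_def)
      show "linear (\<lambda>a. bilin_coord S c h ((snd c \<circ> \<delta>) s) b a)"
        unfolding bilin_coord_def using linear_compose[OF L h2] by (simp add: o_def)
    qed
    have "continuous_on V (\<lambda>s. bilin_coord S c h ((snd c \<circ> \<delta>) s) (u s) (u s))"
    proof (intro continuous_on_linear_family[OF _ lin2 cont(2)]
        continuous_on_linear_family[OF _ lin1 cont(2)])
      fix a b
      have "continuous_on (snd c ` fst c) (\<lambda>y. bilin_coord S c h y a b)"
        using h c unfolding sym_tensor_def by (auto intro: smooth_on_imp_continuous_on)
      then show "continuous_on V (\<lambda>s. bilin_coord S c h ((snd c \<circ> \<delta>) s) a b)"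
        by (rule continuous_on_compose2[OF _ cont(1)]) (use in_c in auto)
    qed
    moreover have "bilin_coord S c h ((snd c \<circ> \<delta>) s) (u s) (u s) =
        h (\<delta> s) (velocity S \<delta> s) (velocity S \<delta> s)" if "s \<in> V" for s
      using that vel in_c smooth_manifoldD(1)[OF S c] by (simp add: bilin_coord_def)
    ultimately have "continuous_on V (\<lambda>s. h (\<delta> s) (velocity S \<delta> s) (velocity S \<delta> s))"
      by (simp cong: continuous_on_cong)
    then show ?thesis using V by (simp add: continuous_on_eq_continuous_at)
  qed
  then show "sym_tensor S h \<Longrightarrow>
      continuous_on J (\<lambda>s. h (\<delta> s) (velocity S \<delta> s) (velocity S \<delta> s))"
    by (simp add: continuous_at_imp_continuous_on)
qed

lemma piecewise_smooth_curve_compose: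
  assumes S: "smooth_manifold S" and S': "smooth_manifold S'" and \<phi>: "smooth_map S S' \<phi>"
    and \<gamma>: "piecewise_smooth_curve S \<gamma> a b"
  shows "piecewise_smooth_curve S' (\<phi> \<circ> \<gamma>) a b"
proof -
  obtain n :: nat and s where s: "a < b" "s 0 = a" "s n = b"
    and pieces: "\<And>i. i < n \<Longrightarrow> s i < s (Suc i) \<and> (\<exists>J \<delta>. open J \<and> {s i..s (Suc i)} \<subseteq> J \<and>
      smooth_map_on euclid S J \<delta> \<and> (\<forall>t\<in>{s i..s (Suc i)}. \<gamma> t = \<delta> t))"
    using \<gamma> unfolding piecewise_curve_def by auto
  have "s i < s (Suc i) \<and> (\<exists>J \<delta>. open J \<and> {s i..s (Suc i)} \<subseteq> J \<and>
      smooth_map_on euclid S' J \<delta> \<and> (\<forall>t\<in>{s i..s (Suc i)}. (\<phi> \<circ> \<gamma>) t = \<delta> t))" if i: "i < n" for i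
  proof -
    obtain J \<delta> where \<delta>: "open J" "{s i..s (Suc i)} \<subseteq> J" "smooth_map_on euclid S J \<delta>"
      "\<forall>t\<in>{s i..s (Suc i)}. \<gamma> t = \<delta> t"
      using pieces[OF i] by blast
    have "smooth_map_on euclid S' J (\<phi> \<circ> \<delta>)"
      by (rule smooth_map_on_compose[OF smooth_manifold_euclid S S' \<delta>(1) open_UNIV _ \<delta>(3) \<phi>]) simp
    moreover have "\<forall>t\<in>{s i..s (Suc i)}. (\<phi> \<circ> \<gamma>) t = (\<phi> \<circ> \<delta>) t" using \<delta>(4) by simp
    ultimately show ?thesis using \<delta>(1,2) pieces[OF i] by blast
  qed
  then show ?thesis using s unfolding piecewise_curve_def by auto
qed

text \<open>The appended piece is traversed in unit time, so it only has to be shifted.\<close>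

lemma piecewise_smooth_curve_append:
  assumes S: "smooth_manifold S" and \<gamma>: "piecewise_smooth_curve S \<gamma> a b"
    and \<delta>: "open J" "{0..1} \<subseteq> J" "smooth_map_on euclid S J \<delta>" "\<delta> 0 = \<gamma> b"
  shows "piecewise_smooth_curve S (\<lambda>t. if t \<le> b then \<gamma> t else \<delta> (t - b)) a (b + 1)"
proof -
  let ?\<gamma> = "\<lambda>t. if t \<le> b then \<gamma> t else \<delta> (t - b)"
  obtain n :: nat and s where s: "a < b" "s 0 = a" "s n = b"
    and pieces: "\<And>i. i < n \<Longrightarrow> s i < s (Suc i) \<and> (\<exists>J \<delta>. open J \<and> {s i..s (Suc i)} \<subseteq> J \<and>
      smooth_map_on euclid S J \<delta> \<and> (\<forall>t\<in>{s i..s (Suc i)}. \<gamma> t = \<delta> t))"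
    using \<gamma> unfolding piecewise_curve_def by auto
  have le: "s i \<le> b" if "i \<le> n" for i
    using that
  proof (induction rule: inc_induct)
    case (step i)
    then show ?case using pieces[of i] by linarith
  qed (simp add: s(3))
  define s' where "s' i = (if i \<le> n then s i else b + 1)" for i
  have "s' i < s' (Suc i) \<and> (\<exists>J \<delta>. open J \<and> {s' i..s' (Suc i)} \<subseteq> J \<and>
      smooth_map_on euclid S J \<delta> \<and> (\<forall>t\<in>{s' i..s' (Suc i)}. ?\<gamma> t = \<delta> t))" if i: "i < Suc n" for i
  proof (cases "i < n")
    case True
    then have s': "s' i = s i" "s' (Suc i) = s (Suc i)" by (simp_all add: s'_def)
    obtain J' \<delta>' where J': "open J'" "{s i..s (Suc i)} \<subseteq> J'" "smooth_map_on euclid S J' \<delta>'"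
      "\<forall>t\<in>{s i..s (Suc i)}. \<gamma> t = \<delta>' t"
      using pieces[OF True] by blast
    have "?\<gamma> t = \<delta>' t" if "t \<in> {s i..s (Suc i)}" for t
      using J'(4) that le[of "Suc i"] True by auto
    then show ?thesis using J' pieces[OF True] unfolding s' by blast
  next
    case False
    then have s': "s' i = b" "s' (Suc i) = b + 1" using i s(3) by (auto simp: s'_def less_Suc_eq)
    let ?J = "(\<lambda>t. t - b) -` J"
    have J: "open ?J" using \<delta>(1) by (auto intro!: continuous_open_vimage continuous_intros)
    have "smooth_on ?J (\<lambda>t. t + - b)"
      using J by (intro smooth_on_add smooth_on_const smooth_on_linear bounded_linear_ident)
    then have "smooth_map_on euclid euclid ?J (\<lambda>t. t - b)" by (simp add: smooth_map_on_euclid_iff)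
    then have "smooth_map_on euclid S ?J (\<delta> \<circ> (\<lambda>t. t - b))"
      by (rule smooth_map_on_compose[OF smooth_manifold_euclid smooth_manifold_euclid S J \<delta>(1) _ _ \<delta>(3),
            rotated]) auto
    moreover have "{b..b + 1} \<subseteq> ?J" by (auto intro!: subsetD[OF \<delta>(2)])
    moreover have "\<forall>t\<in>{b..b + 1}. ?\<gamma> t = (\<delta> \<circ> (\<lambda>t. t - b)) t" using \<delta>(4) by auto
    ultimately show ?thesis using J unfolding s' by (intro conjI exI[of _ ?J] exI[of _ "\<delta> \<circ> (\<lambda>t. t - b)"]) auto
  qed
  moreover have "s' 0 = a" "s' (Suc n) = b + 1" using s by (auto simp: s'_def)
  ultimately show ?thesis
    using s(1) unfolding piecewise_curve_def
    by (intro conjI exI[of _ "Suc n"] exI[of _ s'] allI impI) auto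
qed

text \<open>The preimage of a ball under a chart is a neighbourhood in which any two points are joined by
  the preimage of a straight segment. The segment may be constant.\<close>

lemma chart_segments:
  fixes S :: "('s::{t2_space,second_countable_topology}, 'f::euclidean_space) mfd"
  assumes S: "smooth_manifold S"
  obtains V where "open V" "p \<in> V"
    "\<forall>x\<in>V. \<forall>y\<in>V. \<exists>J \<delta>. open J \<and> {0..1::real} \<subseteq> J \<and> smooth_map_on euclid S J \<delta> \<and>
      \<delta> 0 = x \<and> \<delta> 1 = y"
proof -
  let ?c = "chart_at S p"
  have c: "?c \<in> atlas S" "p \<in> fst ?c" by (simp_all add: smooth_manifoldD(4,5)[OF S])
  note chart = smooth_manifoldD(1)[OF S c(1)]
  have R: "open (snd ?c ` fst ?c)" by (rule open_chart_range[OF S c(1)])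
  then obtain e where e: "e > 0" "ball (snd ?c p) e \<subseteq> snd ?c ` fst ?c"
    using c(2) openE by blast
  let ?V = "fst ?c \<inter> snd ?c -` ball (snd ?c p) e"
  show thesis
  proof
    show "open ?V" using chart by (rule open_chart_preimage) simp
    show "p \<in> ?V" using c e by simp
    show "\<forall>x\<in>?V. \<forall>y\<in>?V. \<exists>J \<delta>. open J \<and> {0..1::real} \<subseteq> J \<and> smooth_map_on euclid S J \<delta> \<and>
        \<delta> 0 = x \<and> \<delta> 1 = y"
    proof (intro ballI)
      fix x y assume x: "x \<in> ?V" and y: "y \<in> ?V"
      let ?l = "\<lambda>t::real. snd ?c x + t *\<^sub>R (snd ?c y - snd ?c x)"
      let ?J = "?l -` (snd ?c ` fst ?c)"
      have J: "open ?J"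
        by (rule continuous_open_vimage[OF R]) (auto intro!: continuous_intros)
      have "?l t \<in> ball (snd ?c p) e" if "t \<in> {0..1::real}" for t
      proof -
        have "(1 - t) *\<^sub>R snd ?c x + t *\<^sub>R snd ?c y \<in> ball (snd ?c p) e"
          using x y that by (intro convexD[OF convex_ball]) auto
        then show ?thesis by (simp add: algebra_simps)
      qed
      then have sub: "{0..1::real} \<subseteq> ?J" using e(2) by blast
      have "smooth_map_on euclid euclid ?J ?l"
        unfolding smooth_map_on_euclid_iff
        using J by (intro smooth_on_add smooth_on_const smooth_on_linear bounded_linear_scaleR_left)
      then have "smooth_map_on euclid S ?J (chart_inv ?c \<circ> ?l)"
        by (rule smooth_map_on_compose[OF smooth_manifold_euclid smooth_manifold_euclid S J R _ _
              smooth_map_on_chart_inv[OF S c(1)], rotated]) auto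
      then show "\<exists>J \<delta>. open J \<and> {0..1::real} \<subseteq> J \<and> smooth_map_on euclid S J \<delta> \<and> \<delta> 0 = x \<and> \<delta> 1 = y"
        using J sub x y chart by (intro exI[of _ ?J] exI[of _ "chart_inv ?c \<circ> ?l"]) auto
    qed
  qed
qed

text \<open>By \<open>chart_segments\<close>, reachability from \<open>p\<close> is a locally constant property, so it holds on all
  of the connected space \<open>S\<close>.\<close>

lemma piecewise_smooth_curve_exists:
  fixes S :: "('s::{t2_space,second_countable_topology}, 'f::euclidean_space) mfd"
  assumes S: "smooth_manifold S" and "connected (UNIV :: 's set)"
  shows "\<exists>\<gamma> a b. piecewise_smooth_curve S \<gamma> a b \<and> \<gamma> a = p \<and> \<gamma> b = q"
proof -
  define R where "R z \<longleftrightarrow> (\<exists>\<gamma> a b. piecewise_smooth_curve S \<gamma> a b \<and> \<gamma> a = p \<and> \<gamma> b = z)" for z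
  have "R q"
  proof (rule connected_induction_simple[OF assms(2), of p q])
    obtain V where "open V" "p \<in> V"
      and "\<forall>x\<in>V. \<forall>y\<in>V. \<exists>J \<delta>. open J \<and> {0..1::real} \<subseteq> J \<and> smooth_map_on euclid S J \<delta> \<and>
        \<delta> 0 = x \<and> \<delta> 1 = y"
      using chart_segments[OF S, of p] .
    then obtain J \<delta> where "open J" "{0..1::real} \<subseteq> J" "smooth_map_on euclid S J \<delta>"
      and ends: "\<delta> 0 = p" "\<delta> 1 = p"
      by blast
    then have "piecewise_smooth_curve S \<delta> 0 1"
      unfolding piecewise_curve_def by (intro conjI exI[of _ "1::nat"] exI[of _ real]) auto
    then show "R p" using ends unfolding R_def by blast
  next
    fix x
    obtain V where V: "open V" "x \<in> V"
      and seg: "\<forall>y\<in>V. \<forall>z\<in>V. \<exists>J \<delta>. open J \<and> {0..1::real} \<subseteq> J \<and> smooth_map_on euclid S J \<delta> \<and>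
        \<delta> 0 = y \<and> \<delta> 1 = z"
      using chart_segments[OF S, of x] .
    have "R z" if yz: "y \<in> V" "z \<in> V" and y: "R y" for y z
    proof -
      obtain \<gamma> a b where \<gamma>: "piecewise_smooth_curve S \<gamma> a b" "\<gamma> a = p" "\<gamma> b = y"
        using y unfolding R_def by blast
      obtain J \<delta> where \<delta>: "open J" "{0..1::real} \<subseteq> J" "smooth_map_on euclid S J \<delta>" "\<delta> 0 = y" "\<delta> 1 = z"
        using seg yz by blast
      let ?\<gamma> = "\<lambda>t. if t \<le> b then \<gamma> t else \<delta> (t - b)"
      have "piecewise_smooth_curve S ?\<gamma> a (b + 1)"
        using piecewise_smooth_curve_append[OF S \<gamma>(1) \<delta>(1,2,3)] \<gamma>(3) \<delta>(4) by simp
      moreover have "a < b" using \<gamma>(1) unfolding piecewise_curve_def by blast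
      then have "?\<gamma> a = p" "?\<gamma> (b + 1) = z" using \<gamma>(2) \<delta>(5) by simp_all
      ultimately show ?thesis unfolding R_def by blast
    qed
    then have "\<forall>y\<in>V. \<forall>z\<in>V. R y \<longrightarrow> R z" by blast
    moreover have "openin (top_of_set UNIV) V" using V(1) by simp
    ultimately show "\<exists>V. openin (top_of_set UNIV) V \<and> x \<in> V \<and> (\<forall>y\<in>V. \<forall>z\<in>V. R y \<longrightarrow> R z)"
      using V(2) by blast
  qed auto
  then show ?thesis unfolding R_def .
qed

section \<open>Lengths and distances\<close>

text \<open>Tangent vectors at different points may be represented in different charts, so continuity of
  \<open>F\<close> in both arguments would have to be stated in coordinates. This condition avoids them and is
  what integration of \<open>F\<close> along curves needs.\<close>

definition continuous_along_curves ::
    "('s::topological_space, 'f::euclidean_space) mfd \<Rightarrow> ('s \<Rightarrow> 'f \<Rightarrow> real) \<Rightarrow> bool" where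
  "continuous_along_curves S F \<longleftrightarrow> (\<forall>J \<delta>. open J \<longrightarrow> smooth_map_on euclid S J \<delta> \<longrightarrow>
     continuous_on J (\<lambda>s. F (\<delta> s) (velocity S \<delta> s)))"

lemma continuous_along_curves_fermat_metric:
  assumes "smooth_manifold S" "riemannian_metric S g0" "one_form S \<omega>"
  shows "continuous_along_curves S (fermat_metric g0 \<omega>)"
  unfolding continuous_along_curves_def
proof (intro allI impI)
  fix J :: "real set" and \<delta> assume J: "open J" and \<delta>: "smooth_map_on euclid S J \<delta>"
  have "sym_tensor S g0" using assms(2) unfolding riemannian_metric_def by blast
  note continuous_on_sym_tensor_velocity[OF assms(1) J \<delta> this]
    continuous_on_one_form_velocity[OF assms(1) J \<delta> assms(3)]
  then show "continuous_on J (\<lambda>s. fermat_metric g0 \<omega> (\<delta> s) (velocity S \<delta> s))"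
    unfolding fermat_metric_def
    by (intro continuous_on_add continuous_on_real_sqrt continuous_on_power)
qed

lemma fermat_metric_nonneg:
  assumes "riemannian_metric S g0"
  shows "0 \<le> fermat_metric g0 \<omega> x v"
proof -
  have "0 \<le> g0 x v v"
  proof (cases "v = 0")
    case True
    then show ?thesis
      using assms linear_0[of "g0 x v"]
      unfolding riemannian_metric_def sym_tensor_def bilinear_def by simp
  qed (use assms in \<open>auto simp: riemannian_metric_def less_imp_le\<close>)
  then have "\<bar>\<omega> x v\<bar> \<le> sqrt (g0 x v v + (\<omega> x v)\<^sup>2)" by (simp add: real_le_rsqrt)
  then show ?thesis unfolding fermat_metric_def by linarith
qed

text \<open>At the end points of a piece, \<open>\<gamma>\<close> may differ from its smooth extension \<open>\<delta>\<close> on the far side, and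
  then its velocity there means nothing; but two points do not affect the integral.\<close>

lemma has_integral_along_piece:
  assumes S: "smooth_manifold S" and J: "open J" "{a..b} \<subseteq> J"
    and \<delta>: "smooth_map_on euclid S J \<delta>" and eq: "\<forall>t\<in>{a..b}. \<gamma> t = \<delta> t"
  shows "((\<lambda>s. F (\<gamma> s) (velocity S \<gamma> s)) has_integral I) {a..b} \<longleftrightarrow>
    ((\<lambda>s. F (\<delta> s) (velocity S \<delta> s)) has_integral I) {a..b}"
proof (rule has_integral_spike_finite_eq[of "{a, b}"])
  fix t assume t: "t \<in> {a..b} - {a, b}"
  have "velocity S \<gamma> t = velocity S \<delta> t"
    unfolding velocity_def
  proof (rule fun_cong[OF mderiv_cong[OF smooth_manifold_euclid S]])
    show "smooth_map_on euclid S {a<..<b} \<delta>"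
      by (rule smooth_map_on_subset[OF \<delta>]) (use J in auto)
  qed (use t eq in auto)
  then show "F (\<delta> t) (velocity S \<delta> t) = F (\<gamma> t) (velocity S \<gamma> t)" using t eq by auto
qed simp

text \<open>If \<open>\<phi>\<close> pulls \<open>F2\<close> back to \<open>F1 + df\<close>, then lengths of curves change by the difference of the
  boundary values of \<open>f\<close>: on each smooth piece, this is the fundamental theorem of calculus for
  \<open>f \<circ> \<delta>\<close>. Existence of the first integral is part of the conclusion, as \<open>integral\<close> would be \<open>0\<close>
  otherwise and the lengths would not correspond.\<close>

lemma length_translate:
  fixes S :: "('s::{t2_space,second_countable_topology}, 'f::euclidean_space) mfd"
    and S' :: "('n::{t2_space,second_countable_topology}, 'h::euclidean_space) mfd"
  assumes S: "smooth_manifold S" and S': "smooth_manifold S'"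
    and \<phi>: "smooth_map S S' \<phi>" and f: "smooth_map S euclid f"
    and F1: "continuous_along_curves S F1"
    and F: "\<And>p v. F2 (\<phi> p) (mderiv S S' \<phi> p v) = F1 p v + mderiv S euclid f p v"
    and \<gamma>: "piecewise_smooth_curve S \<gamma> a b"
  shows "\<exists>I. ((\<lambda>s. F1 (\<gamma> s) (velocity S \<gamma> s)) has_integral I) {a..b} \<and>
    ((\<lambda>s. F2 ((\<phi> \<circ> \<gamma>) s) (velocity S' (\<phi> \<circ> \<gamma>) s)) has_integral I + (f (\<gamma> b) - f (\<gamma> a))) {a..b}"
proof -
  let ?L = "\<lambda>a b. \<exists>I. ((\<lambda>s. F1 (\<gamma> s) (velocity S \<gamma> s)) has_integral I) {a..b} \<and>
    ((\<lambda>s. F2 ((\<phi> \<circ> \<gamma>) s) (velocity S' (\<phi> \<circ> \<gamma>) s)) has_integral I + (f (\<gamma> b) - f (\<gamma> a))) {a..b}"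
  obtain n :: nat and s where s: "a < b" "s 0 = a" "s n = b"
    and pieces: "\<And>i. i < n \<Longrightarrow> s i < s (Suc i) \<and> (\<exists>J \<delta>. open J \<and> {s i..s (Suc i)} \<subseteq> J \<and>
      smooth_map_on euclid S J \<delta> \<and> (\<forall>t\<in>{s i..s (Suc i)}. \<gamma> t = \<delta> t))"
    using \<gamma> unfolding piecewise_curve_def by auto
  have piece: "?L (s i) (s (Suc i))" if i: "i < n" for i
  proof -
    obtain J \<delta> where J: "open J" "{s i..s (Suc i)} \<subseteq> J" and \<delta>: "smooth_map_on euclid S J \<delta>"
      and eq: "\<forall>t\<in>{s i..s (Suc i)}. \<gamma> t = \<delta> t"
      using pieces[OF i] by blast
    have le: "s i \<le> s (Suc i)" using pieces[OF i] by simp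
    have \<phi>\<delta>: "smooth_map_on euclid S' J (\<phi> \<circ> \<delta>)"
      by (rule smooth_map_on_compose[OF smooth_manifold_euclid S S' J(1) open_UNIV _ \<delta> \<phi>]) simp
    have f\<delta>: "smooth_map_on euclid euclid J (f \<circ> \<delta>)"
      by (rule smooth_map_on_compose[OF smooth_manifold_euclid S smooth_manifold_euclid J(1) open_UNIV _ \<delta> f]) simp
    have "(\<lambda>s. F1 (\<delta> s) (velocity S \<delta> s)) integrable_on {s i..s (Suc i)}"
      using F1 J \<delta> unfolding continuous_along_curves_def
      by (intro integrable_continuous_real) (auto intro: continuous_on_subset)
    then obtain I where I: "((\<lambda>s. F1 (\<delta> s) (velocity S \<delta> s)) has_integral I) {s i..s (Suc i)}"
      by (auto simp: integrable_on_def)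
    have "(velocity euclid (f \<circ> \<delta>) has_integral (f \<circ> \<delta>) (s (Suc i)) - (f \<circ> \<delta>) (s i)) {s i..s (Suc i)}"
    proof (rule fundamental_theorem_of_calculus[OF le has_vector_derivative_at_within])
      fix t assume "t \<in> {s i..s (Suc i)}"
      then show "(f \<circ> \<delta> has_vector_derivative velocity euclid (f \<circ> \<delta>) t) (at t)"
        using velocity_euclid[OF J(1) f\<delta>] J(2) by blast
    qed
    then have "((\<lambda>s. F1 (\<delta> s) (velocity S \<delta> s) + velocity euclid (f \<circ> \<delta>) s) has_integral
        I + (f (\<gamma> (s (Suc i))) - f (\<gamma> (s i)))) {s i..s (Suc i)}"
      using has_integral_add[OF I] eq le by auto
    moreover have "F1 (\<delta> t) (velocity S \<delta> t) + velocity euclid (f \<circ> \<delta>) t =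
        F2 ((\<phi> \<circ> \<delta>) t) (velocity S' (\<phi> \<circ> \<delta>) t)" if "t \<in> {s i..s (Suc i)}" for t
      using that J(2) F velocity_compose[OF S S' J(1) open_UNIV \<delta> \<phi>]
        velocity_compose[OF S smooth_manifold_euclid J(1) open_UNIV \<delta> f] by auto
    ultimately have "((\<lambda>s. F2 ((\<phi> \<circ> \<delta>) s) (velocity S' (\<phi> \<circ> \<delta>) s)) has_integral
        I + (f (\<gamma> (s (Suc i))) - f (\<gamma> (s i)))) {s i..s (Suc i)}"
      by (rule has_integral_eq[rotated])
    then show ?thesis
      using I has_integral_along_piece[OF S J \<delta> eq, of F1]
        has_integral_along_piece[OF S' J \<phi>\<delta>, of "\<phi> \<circ> \<gamma>" F2] eq by auto
  qed
  have "s 0 \<le> s m \<and> ?L (s 0) (s m)" if "m \<le> n" for m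
    using that
  proof (induction m)
    case 0
    show ?case using has_integral_refl(2)[of _ "s 0"] by (intro conjI exI[of _ 0]) simp_all
  next
    case (Suc m)
    then have m: "s 0 \<le> s m" "s m \<le> s (Suc m)" using pieces[of m] by auto
    obtain I where I: "((\<lambda>s. F1 (\<gamma> s) (velocity S \<gamma> s)) has_integral I) {s 0..s m}"
      "((\<lambda>s. F2 ((\<phi> \<circ> \<gamma>) s) (velocity S' (\<phi> \<circ> \<gamma>) s)) has_integral I + (f (\<gamma> (s m)) - f (\<gamma> (s 0)))) {s 0..s m}"
      using Suc.IH Suc_leD[OF Suc.prems] by blast
    obtain I' where I': "((\<lambda>s. F1 (\<gamma> s) (velocity S \<gamma> s)) has_integral I') {s m..s (Suc m)}"
      "((\<lambda>s. F2 ((\<phi> \<circ> \<gamma>) s) (velocity S' (\<phi> \<circ> \<gamma>) s)) has_integral I' + (f (\<gamma> (s (Suc m))) - f (\<gamma> (s m)))) {s m..s (Suc m)}"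
      using piece[of m] Suc.prems Suc_le_lessD by blast
    have "((\<lambda>s. F1 (\<gamma> s) (velocity S \<gamma> s)) has_integral I + I') {s 0..s (Suc m)}"
      by (rule has_integral_combine[OF m I(1) I'(1)])
    moreover have "((\<lambda>s. F2 ((\<phi> \<circ> \<gamma>) s) (velocity S' (\<phi> \<circ> \<gamma>) s)) has_integral
        (I + I') + (f (\<gamma> (s (Suc m))) - f (\<gamma> (s 0)))) {s 0..s (Suc m)}"
      using has_integral_combine[OF m I(2) I'(2)] by (simp add: algebra_simps)
    ultimately show ?case using order_trans[OF m] by blast
  qed
  from this[of n] show ?thesis using s by simp
qed

lemma diffeomorphismD:
  assumes "diffeomorphism M N f"
  shows "bij f" "smooth_map M N f" "smooth_map N M (inv f)" "f (inv f q) = q" "inv f (f p) = p"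
  using assms unfolding diffeomorphism_def
  by (auto simp: bij_is_surj surj_f_inv_f bij_is_inj)

text \<open>As \<open>\<phi>\<close> is a diffeomorphism, composition with it is a bijection from the curves between \<open>x\<close> and
  \<open>y\<close> to those between their images, and it adds the constant \<open>f y - f x\<close> to all lengths. The
  constant may be taken out of the infimum because there is a curve and lengths are bounded below.\<close>

lemma finsler_dist_translate:
  fixes S :: "('s::{t2_space,second_countable_topology}, 'f::euclidean_space) mfd"
    and S' :: "('n::{t2_space,second_countable_topology}, 'h::euclidean_space) mfd"
  assumes S: "smooth_manifold S" and S': "smooth_manifold S'" and conn: "connected (UNIV :: 's set)"
    and \<phi>: "diffeomorphism S S' \<phi>" and f: "smooth_map S euclid f"
    and F1: "continuous_along_curves S F1" "\<And>p v. 0 \<le> F1 p v"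
    and F: "\<And>p v. F2 (\<phi> p) (mderiv S S' \<phi> p v) = F1 p v + mderiv S euclid f p v"
  shows "finsler_dist S' F2 (\<phi> x) (\<phi> y) = finsler_dist S F1 x y + (f y - f x)"
proof -
  define len1 where "len1 = (\<lambda>(\<gamma>, a, b). integral {a..b} (\<lambda>s. F1 (\<gamma> s) (velocity S \<gamma> s)))"
  define len2 where "len2 = (\<lambda>(\<gamma>, a, b). integral {a..b} (\<lambda>s. F2 (\<gamma> s) (velocity S' \<gamma> s)))"
  define C where "C = {(\<gamma>, a, b). piecewise_smooth_curve S \<gamma> a b \<and> \<gamma> a = x \<and> \<gamma> b = y}"
  define C' where "C' = {(\<gamma>, a, b). piecewise_smooth_curve S' \<gamma> a b \<and> \<gamma> a = \<phi> x \<and> \<gamma> b = \<phi> y}"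
  let ?push = "\<lambda>(\<gamma>, a, b). (\<phi> \<circ> \<gamma>, a, b)"
  note \<phi>' = diffeomorphismD[OF \<phi>]
  have dist1: "finsler_dist S F1 x y = Inf (len1 ` C)"
    unfolding finsler_dist_def len1_def C_def by (rule arg_cong[of _ _ Inf]) (auto simp: image_def)
  have dist2: "finsler_dist S' F2 (\<phi> x) (\<phi> y) = Inf (len2 ` C')"
    unfolding finsler_dist_def len2_def C'_def by (rule arg_cong[of _ _ Inf]) (auto simp: image_def)
  have push: "C' = ?push ` C"
  proof (intro equalityI subsetI)
    fix z assume "z \<in> ?push ` C"
    then show "z \<in> C'"
      unfolding C_def C'_def using piecewise_smooth_curve_compose[OF S S' \<phi>'(2)] by auto
  next
    fix z assume "z \<in> C'"
    then obtain \<gamma> a b where z: "z = (\<gamma>, a, b)"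
      and \<gamma>: "piecewise_smooth_curve S' \<gamma> a b" "\<gamma> a = \<phi> x" "\<gamma> b = \<phi> y"
      unfolding C'_def by auto
    have "(inv \<phi> \<circ> \<gamma>, a, b) \<in> C"
      using piecewise_smooth_curve_compose[OF S' S \<phi>'(3) \<gamma>(1)] \<gamma>(2,3) \<phi>'(5) by (simp add: C_def)
    moreover have "z = ?push (inv \<phi> \<circ> \<gamma>, a, b)"
      unfolding z using \<phi>'(4) by (simp add: fun_eq_iff)
    ultimately show "z \<in> ?push ` C" by (rule rev_image_eqI)
  qed
  have len: "0 \<le> len1 z \<and> len2 (?push z) = (f y - f x) + len1 z" if zC: "z \<in> C" for z
  proof -
    obtain \<gamma> a b where z: "z = (\<gamma>, a, b)"
      and \<gamma>: "piecewise_smooth_curve S \<gamma> a b" "\<gamma> a = x" "\<gamma> b = y"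
      using zC unfolding C_def by auto
    obtain I where I: "((\<lambda>s. F1 (\<gamma> s) (velocity S \<gamma> s)) has_integral I) {a..b}"
      "((\<lambda>s. F2 ((\<phi> \<circ> \<gamma>) s) (velocity S' (\<phi> \<circ> \<gamma>) s)) has_integral I + (f (\<gamma> b) - f (\<gamma> a))) {a..b}"
      using length_translate[OF S S' \<phi>'(2) f F1(1) F \<gamma>(1)] by blast
    have "0 \<le> I" using has_integral_nonneg[OF I(1)] F1(2) by simp
    then show ?thesis
      using integral_unique[OF I(1)] integral_unique[OF I(2)] \<gamma>(2,3)
      by (simp add: z len1_def len2_def)
  qed
  obtain \<gamma> a b where "piecewise_smooth_curve S \<gamma> a b" "\<gamma> a = x" "\<gamma> b = y"
    using piecewise_smooth_curve_exists[OF S conn] by blast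
  then have "(\<gamma>, a, b) \<in> C" by (simp add: C_def)
  then have "C \<noteq> {}" by blast
  moreover have "bdd_below (len1 ` C)" using len by (intro bdd_belowI2[of _ 0]) simp
  ultimately have "(INF z\<in>C. (f y - f x) + len1 z) = (f y - f x) + Inf (len1 ` C)"
    by (intro Inf_add_eq)
  moreover have "len2 ` C' = (\<lambda>z. (f y - f x) + len1 z) ` C"
    unfolding push image_image using len by (intro image_cong) auto
  ultimately show ?thesis using dist1 dist2 by simp
qed

section \<open>Diffeomorphisms preserving the line direction\<close>

lemma diffeomorphism_compose:
  assumes "smooth_manifold M" "smooth_manifold N" "smooth_manifold P"
    and f: "diffeomorphism M N f" and g: "diffeomorphism N P g"
  shows "diffeomorphism M P (g \<circ> f)"
  unfolding diffeomorphism_def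
proof (intro conjI)
  note f' = diffeomorphismD[OF f] and g' = diffeomorphismD[OF g]
  show "bij (g \<circ> f)" using f'(1) g'(1) by (rule bij_comp)
  show "smooth_map M P (g \<circ> f)"
    using smooth_map_on_compose[OF assms(1-3) open_UNIV open_UNIV _ f'(2) g'(2)] by simp
  show "smooth_map P M (inv (g \<circ> f))"
    using smooth_map_on_compose[OF assms(3,2,1) open_UNIV open_UNIV _ g'(3) f'(3)]
      o_inv_distrib[OF g'(1) f'(1)] by simp
qed

lemma diffeomorphism_inv:
  assumes "diffeomorphism M N f"
  shows "diffeomorphism N M (inv f)"
  using diffeomorphismD[OF assms] bij_imp_bij_inv inv_inv_eq unfolding diffeomorphism_def by metis

context
  fixes S :: "('s::{t2_space,second_countable_topology}, 'f::euclidean_space) mfd"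
    and S' :: "('n::{t2_space,second_countable_topology}, 'h::euclidean_space) mfd"
    and G :: "'s \<times> real \<Rightarrow> 'n \<times> real"
  assumes S: "smooth_manifold S" and S': "smooth_manifold S'"
    and G: "diffeomorphism (times_line S) (times_line S') G"
    and field: "\<And>z. mderiv (times_line S) (times_line S') G z (0, 1) = (0, 1)"
begin

private abbreviation (input) "\<phi> \<equiv> \<lambda>x. fst (G (x, 0))"
private abbreviation (input) "f \<equiv> \<lambda>x. snd (G (x, 0))"

lemma
  shows smooth_map_base: "smooth_map S S' \<phi>"
    and smooth_map_shift: "smooth_map S euclid f"
    and mderiv_base_shift: "mderiv (times_line S) (times_line S') G (x, 0) (v, \<tau>) =
      (mderiv S S' \<phi> x v, mderiv S euclid f x v + \<tau>)"
proof -
  note L = smooth_manifold_times_line[OF S] and L' = smooth_manifold_times_line[OF S']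
  note E = smooth_manifold_euclid and U = open_UNIV
  note G' = diffeomorphismD(2)[OF G]
  let ?G0 = "G \<circ> (\<lambda>x. (x, 0))"
  have G0: "smooth_map S (times_line S') ?G0"
    by (rule smooth_map_on_compose[OF S L L' U U _ smooth_map_slice[OF S] G']) simp
  show "smooth_map S S' \<phi>" "smooth_map S euclid f"
    using smooth_map_on_compose[OF S L' S' U U _ G0 smooth_map_fst[OF S']]
      smooth_map_on_compose[OF S L' E U U _ G0 smooth_map_snd[OF S']] by (simp_all add: o_def)
  have "mderiv S (times_line S') ?G0 x v = mderiv (times_line S) (times_line S') G (x, 0) (v, 0)"
    using mderiv_compose[OF S L L' U U smooth_map_slice[OF S] G'] by (simp add: mderiv_slice[OF S])
  then have d0: "mderiv (times_line S) (times_line S') G (x, 0) (v, 0) =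
      (mderiv S S' \<phi> x v, mderiv S euclid f x v)"
    using mderiv_compose[OF S L' S' U U G0 smooth_map_fst[OF S']]
      mderiv_compose[OF S L' E U U G0 smooth_map_snd[OF S']]
    by (simp add: o_def mderiv_fst[OF S'] mderiv_snd[OF S'] prod_eq_iff)
  interpret linear "mderiv (times_line S) (times_line S') G (x, 0)"
    by (rule linear_mderiv[OF L L' U G']) simp
  have "mderiv (times_line S) (times_line S') G (x, 0) ((v, 0) + \<tau> *\<^sub>R (0, 1)) =
      (mderiv S S' \<phi> x v, mderiv S euclid f x v) + \<tau> *\<^sub>R (0, 1)"
    by (simp only: add scale d0 field)
  then show "mderiv (times_line S) (times_line S') G (x, 0) (v, \<tau>) =
      (mderiv S S' \<phi> x v, mderiv S euclid f x v + \<tau>)"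
    by simp
qed

text \<open>The inverse of \<open>\<phi>\<close> is obtained from that of \<open>G\<close> in the same way as \<open>\<phi>\<close> from \<open>G\<close>, because \<open>G\<close>
  commutes with translations; hence it is smooth.\<close>

lemma diffeomorphism_base: "diffeomorphism S S' \<phi>"
  unfolding diffeomorphism_def
proof (intro conjI smooth_map_base)
  note G' = diffeomorphismD[OF G]
  have shift: "G (x, t) = (\<phi> x, t + f x)" for x t
    by (rule translation_equivariant[OF S S' G'(2) field])
  have inj: "inj \<phi>"
  proof (rule injI)
    fix x y assume "\<phi> x = \<phi> y"
    then have "G (x, f y) = G (y, f x)" by (simp add: shift[of _ "f _"])
    then show "x = y" using bij_is_inj[OF G'(1)] by (auto dest: injD)
  qed
  have inv: "\<phi> (fst (inv G (y, 0))) = y" for y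
    using shift[of "fst (inv G (y, 0))" "snd (inv G (y, 0))"] G'(4) by simp
  then have "surj \<phi>" by (rule surjI)
  with inj show "bij \<phi>" by (rule bijI)
  have "smooth_map S' S (fst \<circ> (inv G \<circ> (\<lambda>y. (y, 0))))"
    using smooth_manifold_times_line[OF S] smooth_manifold_times_line[OF S'] S S'
    by (intro smooth_map_on_compose[OF _ _ _ open_UNIV open_UNIV _ _ smooth_map_fst]
        smooth_map_on_compose[OF _ _ _ open_UNIV open_UNIV _ smooth_map_slice G'(3)]) auto
  moreover have "inv \<phi> = fst \<circ> (inv G \<circ> (\<lambda>y. (y, 0)))"
    using inv_f_eq[OF inj inv] by auto
  ultimately show "smooth_map S' S (inv \<phi>)" by simp
qed

end

text \<open>In the triangular function, \<open>f y - f x\<close>, \<open>f z - f y\<close> and \<open>- (f z - f x)\<close> add up to zero.\<close>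

lemma almost_isometry_translate:
  assumes "bij \<phi>"
    and "\<And>x y. finsler_dist S F2 (\<phi> x) (\<phi> y) = finsler_dist S F1 x y + (f y - f x)"
  shows "almost_isometry S F1 F2 \<phi>"
  using assms by (simp add: almost_isometry_def triangular_def)

theorem theorem4p3:
  fixes M :: "('m::{t2_space,second_countable_topology}, 'e::euclidean_space) mfd"
    and g :: "'m \<Rightarrow> 'e \<Rightarrow> 'e \<Rightarrow> real"
    and T K W :: "'m \<Rightarrow> 'e"
    and \<psi> :: "'m \<Rightarrow> 'm"
    and S :: "('s::{t2_space,second_countable_topology}, 'f::euclidean_space) mfd"
    and \<Phi>K \<Phi>W :: "'s \<times> real \<Rightarrow> 'm"
    and \<Omega>K \<Omega>W :: "'s \<times> real \<Rightarrow> real"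
    and gK gW :: "'s \<Rightarrow> 'f \<Rightarrow> 'f \<Rightarrow> real"
    and \<omega>K \<omega>W :: "'s \<Rightarrow> 'f \<Rightarrow> real"
  assumes "spacetime M g T"
    and "distinguishing M g T"
    and "conformastationary M g"
    and "conformal_map M g M g \<psi>"
    and "K \<in> CTF M g"
    and "W = pushforward M M \<psi> K"
    and "smooth_manifold S"
    and "conformastationary_decomposition M g K S \<Phi>K \<Omega>K gK \<omega>K"
    and "conformastationary_decomposition M g W S \<Phi>W \<Omega>W gW \<omega>W"
  shows "\<exists>(\<phi> :: 's \<Rightarrow> 's) (f :: 's \<Rightarrow> real).
           (\<forall>x t. (inv \<Phi>W \<circ> \<psi> \<circ> \<Phi>K) (x, t) = (\<phi> x, t + f x)) \<and>
           almost_isometry S (fermat_metric gK \<omega>K) (fermat_metric gW \<omega>W) \<phi>"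
proof -
  have M: "smooth_manifold M" and connM: "connected (UNIV :: 'm set)"
    using assms(1) unfolding spacetime_def by auto
  note S = assms(7)
  note L = smooth_manifold_times_line[OF S] and U = open_UNIV
  let ?L = "times_line S"
  obtain \<mu> where \<psi>: "diffeomorphism M M \<psi>" and \<mu>: "\<And>p. 0 < \<mu> p"
    and conf: "\<And>p u v. g (\<psi> p) (mderiv M M \<psi> p u) (mderiv M M \<psi> p v) = \<mu> p * g p u v"
    using assms(4) unfolding conformal_map_def by blast
  have \<Phi>K: "diffeomorphism ?L M \<Phi>K" and KK: "\<And>z. mderiv ?L M \<Phi>K z (0, 1) = K (\<Phi>K z)"
    and \<Omega>K: "\<And>z. 0 < \<Omega>K z" and gK: "riemannian_metric S gK" and \<omega>K: "one_form S \<omega>K"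
    and mK: "\<And>x t v \<tau>. g (\<Phi>K (x, t)) (mderiv ?L M \<Phi>K (x, t) (v, \<tau>)) (mderiv ?L M \<Phi>K (x, t) (v, \<tau>)) =
      \<Omega>K (x, t) * (gK x v v + 2 * \<omega>K x v * \<tau> - \<tau>\<^sup>2)"
    using assms(8) unfolding conformastationary_decomposition_def by auto
  have \<Phi>W: "diffeomorphism ?L M \<Phi>W" and WW: "\<And>z. mderiv ?L M \<Phi>W z (0, 1) = W (\<Phi>W z)"
    and \<Omega>W: "\<And>z. 0 < \<Omega>W z"
    and mW: "\<And>x t v \<tau>. g (\<Phi>W (x, t)) (mderiv ?L M \<Phi>W (x, t) (v, \<tau>)) (mderiv ?L M \<Phi>W (x, t) (v, \<tau>)) =
      \<Omega>W (x, t) * (gW x v v + 2 * \<omega>W x v * \<tau> - \<tau>\<^sup>2)"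
    using assms(9) unfolding conformastationary_decomposition_def by auto
  define G where "G = inv \<Phi>W \<circ> \<psi> \<circ> \<Phi>K"
  have G: "diffeomorphism ?L ?L G"
    unfolding G_def
    by (intro diffeomorphism_compose[OF L M L \<Phi>K] diffeomorphism_compose[OF M M L \<psi>]
        diffeomorphism_inv \<Phi>W)
  note K' = diffeomorphismD[OF \<Phi>K] and W' = diffeomorphismD[OF \<Phi>W]
    and \<psi>' = diffeomorphismD[OF \<psi>] and G' = diffeomorphismD[OF G]
  have comm: "\<Phi>W (G z) = \<psi> (\<Phi>K z)" for z using W'(4) by (simp add: G_def)
  \<comment> \<open>The differential of \<open>\<Phi>W \<circ> G = \<psi> \<circ> \<Phi>K\<close>, by the chain rule on both sides.\<close>
  have dcomm: "mderiv ?L M \<Phi>W (G z) (mderiv ?L ?L G z u) =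
      mderiv M M \<psi> (\<Phi>K z) (mderiv ?L M \<Phi>K z u)" for z u
  proof -
    have "\<Phi>W \<circ> G = \<psi> \<circ> \<Phi>K" using comm by (simp add: fun_eq_iff)
    then show ?thesis
      using mderiv_compose[OF L L M U U G'(2) W'(2)] mderiv_compose[OF L M M U U K'(2) \<psi>'(2)]
      by (metis UNIV_I)
  qed
  have inv_d: "mderiv M ?L (inv \<Phi>W) (\<Phi>W z) (mderiv ?L M \<Phi>W z u) = u" for z u
    by (rule mderiv_left_inverse[OF L M U U W'(2,3)]) (simp_all add: W'(5))
  have field: "mderiv ?L ?L G z (0, 1) = (0, 1)" for z
  proof -
    have "mderiv ?L M \<Phi>W (G z) (mderiv ?L ?L G z (0, 1)) = W (\<psi> (\<Phi>K z))"
      using dcomm KK \<psi>'(5) by (simp add: assms(6) pushforward_def)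
    \<comment> \<open>Here \<open>W\<close> is the pushforward of \<open>K\<close> and also the image of the coordinate field under \<open>\<Phi>W\<close>.\<close>
    also have "\<dots> = mderiv ?L M \<Phi>W (G z) (0, 1)" using WW comm by simp
    finally show ?thesis using inv_d by metis
  qed
  define \<phi> f where "\<phi> = (\<lambda>x. fst (G (x, 0)))" and "f = (\<lambda>x. snd (G (x, 0)))"
  have \<phi>: "diffeomorphism S S \<phi>" and f: "smooth_map S euclid f"
    unfolding \<phi>_def f_def
    using diffeomorphism_base[OF S S G field] smooth_map_shift[OF S S G field] by simp_all
  have F: "fermat_metric gW \<omega>W (\<phi> x) (mderiv S S \<phi> x v) =
      fermat_metric gK \<omega>K x v + mderiv S euclid f x v" for x v
  \<comment> \<open>Both sides of the equation are the metric at the image of \<open>(v, \<tau>)\<close> under \<open>\<psi> \<circ> \<Phi>K = \<Phi>W \<circ> G\<close>.\<close>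
  proof (rule fermat_metric_translate)
    show "0 < \<Omega>W (G (x, 0))" by (rule \<Omega>W)
    fix \<tau>
    let ?z = "(x, 0)" and ?u = "(mderiv S S \<phi> x v, \<tau> + mderiv S euclid f x v)"
    have dG: "mderiv ?L ?L G ?z (v, \<tau>) = ?u"
      using mderiv_base_shift[OF S S G field] by (simp add: \<phi>_def f_def add.commute)
    have Gz: "G ?z = (\<phi> x, f x)" by (simp add: \<phi>_def f_def)
    have "\<Omega>W (G ?z) * (gW (\<phi> x) (fst ?u) (fst ?u) + 2 * \<omega>W (\<phi> x) (fst ?u) * snd ?u - (snd ?u)\<^sup>2) =
        g (\<Phi>W (G ?z)) (mderiv ?L M \<Phi>W (G ?z) ?u) (mderiv ?L M \<Phi>W (G ?z) ?u)"
      unfolding Gz mW by simp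
    also have "\<dots> = \<mu> (\<Phi>K ?z) * g (\<Phi>K ?z) (mderiv ?L M \<Phi>K ?z (v, \<tau>)) (mderiv ?L M \<Phi>K ?z (v, \<tau>))"
      using conf dcomm[of ?z "(v, \<tau>)"] by (simp add: dG comm)
    finally show "\<Omega>W (G (x, 0)) * (gW (\<phi> x) (mderiv S S \<phi> x v) (mderiv S S \<phi> x v) +
        2 * \<omega>W (\<phi> x) (mderiv S S \<phi> x v) * (\<tau> + mderiv S euclid f x v) -
        (\<tau> + mderiv S euclid f x v)\<^sup>2) =
      (\<mu> (\<Phi>K ?z) * \<Omega>K ?z) * (gK x v v + 2 * \<omega>K x v * \<tau> - \<tau>\<^sup>2)"
      by (simp add: mK mult.assoc)
  qed
  \<comment> \<open>\<open>S\<close> is a continuous image of the connected space \<open>M\<close>.\<close>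
  have "connected (fst ` inv \<Phi>K ` (UNIV :: 'm set))"
    using connM smooth_map_on_imp_continuous_on[OF K'(3)]
    by (intro connected_continuous_image continuous_intros)
  moreover have "fst ` inv \<Phi>K ` (UNIV :: 'm set) = (UNIV :: 's set)"
    using bij_is_surj[OF bij_imp_bij_inv[OF K'(1)]] by simp
  ultimately have conn: "connected (UNIV :: 's set)" by simp
  have "almost_isometry S (fermat_metric gK \<omega>K) (fermat_metric gW \<omega>W) \<phi>"
    by (rule almost_isometry_translate[OF diffeomorphismD(1)[OF \<phi>] finsler_dist_translate[OF S S conn
          \<phi> f continuous_along_curves_fermat_metric[OF S gK \<omega>K] fermat_metric_nonneg[OF gK] F]])
  moreover have "\<forall>x t. G (x, t) = (\<phi> x, t + f x)"
    unfolding \<phi>_def f_def using translation_equivariant[OF S S G'(2) field] by blast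
  ultimately show ?thesis unfolding G_def by blast
qed

end
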